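(* Let $N\geq 1$, $k\geq1$ an integer, $p\geq1$, and $R\in(0,\infty]$. If $u\in W^{k,p}_{\mathbb H,\mathrm{rad}}(B_R^{\mathbb H})$ and $v\colon(0,R)\to\mathbb R$ is such that $u(x)=v(d(x))$, then $v\in W^{k,p}((0,R),\sinh^{N-1}(t))$. Moreover, \[ |\nabla^ku(x)|_g\geq|v^{(k)}(d(x))|,\quad\forall x\in B_R^{\mathbb H}\setminus\{0\}. \]
   Context: $\mathbb H^N$ is the Poincaré ball $\{x\in\mathbb R^N:|x|<1\}$ with metric $g_{ij}=\left(\frac{2}{1-|x|^2}\right)^2\delta_{ij}$, volume element $\mathrm dV_g=\left(\frac{2}{1-|x|^2}\right)^N\mathrm dx$, and distance to the origin $d(x)=\log\frac{1+|x|}{1-|x|}$. For $R\in(0,\infty]$, $B_R^{\mathbb H}=\{x\in\mathbb H^N:d(x)<R\}$ (so $B_\infty^{\mathbb H}=\mathbb H^N$). A function $u$ on $B_R^{\mathbb H}$ is radial if $u(x)=v(d(x))$ for some $v\colon(0,R)\to\mathbb R$. For a smooth function $u$, $\nabla^ju$ denotes the $j$-th covariant derivative (a $j$-covariant tensor, with Christoffel symbols $\Gamma^k_{ij}=\frac{2}{1-|x|^2}(x_i\delta_{jk}+x_j\delta_{ik}-x_k\delta_{ij})$), and $|\nabla^ju|_g^2=\left(\frac{1-|x|^2}{2}\right)^{2j}\sum_{i_1,\dots,i_j}(\nabla^ju)_{i_1\dots i_j}^2$. For a Riemannian manifold $M$, $W^{k,p}(M)$ is the completion of $\{u\in C^\infty(M):\int_M|\nabla^ju|_g^p\mathrm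 dV_g<\infty,\ j=0,\dots,k\}$ under the norm $\|u\|_{W^{k,p}(M)}=\left(\sum_{j=0}^k\int_M|\nabla^ju|_g^p\mathrm dV_g\right)^{1/p}$ (with $\nabla^ju$ defined as $L^p$-limits for elements of the completion); $W^{k,p}_{\mathbb H,\mathrm{rad}}(B_R^{\mathbb H})$ is the subspace of radial functions in $W^{k,p}(B_R^{\mathbb H})$. $W^{k,p}((0,R),\sinh^{N-1}(t))$ is the space of functions $v\colon(0,R)\to\mathbb R$ with weak derivatives up to order $k$ such that $\|v\|_{W^{k,p}_{\sinh^{N-1}}}=\left(\sum_{j=0}^k\int_0^R|v^{(j)}(t)|^p\sinh^{N-1}(t)\mathrm dt\right)^{1/p}<\infty$. Pointwise values refer to the continuous representatives.
   Formalization: The inequality is proved for almost every x in the ball minus the origin instead of every x, since for a general Sobolev function the k-th derivatives of u and v are only L^p classes without pointwise values; where they are continuous, the inequality everywhere follows by continuity. *)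

theory Defs
  imports "HOL-Analysis.Analysis"
begin

section \<open>Poincare ball model of hyperbolic space H^N, N = DIM('a)\<close>

definition hdist :: "'a::euclidean_space \<Rightarrow> real" where
  "hdist x = ln ((1 + norm x) / (1 - norm x))"

definition hconf :: "'a::euclidean_space \<Rightarrow> real" where
  "hconf x = 2 / (1 - (norm x)^2)"

definition hdens :: "'a::euclidean_space \<Rightarrow> real" where
  "hdens x = (hconf x) ^ DIM('a)"

definition hball :: "ereal \<Rightarrow> 'a::euclidean_space set" where
  "hball R = {x. norm x < 1 \<and> ereal (hdist x) < R}"

text \<open>Christoffel symbols Gamma^l_{ij}(x) with i,j,l basis vectors, x_i = x \<bullet> i.\<close>
definition christoffel :: "'a::euclidean_space \<Rightarrow> 'a \<Rightarrow> 'a \<Rightarrow> 'a \<Rightarrow> real" where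
  "christoffel x l i j = hconf x *
     ((x \<bullet> i) * (if j = l then 1 else 0) + (x \<bullet> j) * (if i = l then 1 else 0)
      - (x \<bullet> l) * (if i = j then 1 else 0))"

fun pderivs :: "'a::euclidean_space list \<Rightarrow> ('a \<Rightarrow> real) \<Rightarrow> 'a \<Rightarrow> real" where
  "pderivs [] f = f"
| "pderivs (i # is) f = (\<lambda>x. frechet_derivative (pderivs is f) (at x) i)"

definition smooth_on :: "'a::euclidean_space set \<Rightarrow> ('a \<Rightarrow> real) \<Rightarrow> bool" where
  "smooth_on S f \<longleftrightarrow> (\<forall>is. set is \<subseteq> Basis \<longrightarrow> pderivs is f differentiable_on S)"

text \<open>Components of the covariant derivative: cov is u x = (nabla^j u)_{is}(x) for
  is a list of j basis vectors. The newest differentiation index is the head of the list: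
  (nabla T)_{k, i_1..i_j} = d_k T_{i_1..i_j} - sum_m sum_l Gamma^l_{k i_m} T_{i_1..l..i_j}.\<close>
fun cov :: "'a::euclidean_space list \<Rightarrow> ('a \<Rightarrow> real) \<Rightarrow> 'a \<Rightarrow> real" where
  "cov [] u = u"
| "cov (k # is) u = (\<lambda>x. frechet_derivative (cov is u) (at x) k
      - (\<Sum>m<length is. \<Sum>l\<in>Basis. christoffel x l k (is ! m) * cov (is[m := l]) u x))"

definition idx :: "nat \<Rightarrow> 'a::euclidean_space list set" where
  "idx j = {is. set is \<subseteq> Basis \<and> length is = j}"

definition tnorm :: "nat \<Rightarrow> ('a::euclidean_space list \<Rightarrow> real) \<Rightarrow> 'a \<Rightarrow> real" where
  "tnorm j T x = ((1 - (norm x)^2) / 2) ^ j * sqrt (\<Sum>is\<in>idx j. (T is)^2)"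

definition hsmooth_class :: "nat \<Rightarrow> real \<Rightarrow> ereal \<Rightarrow> ('a::euclidean_space \<Rightarrow> real) \<Rightarrow> bool" where
  "hsmooth_class k p R u \<longleftrightarrow> smooth_on (hball R) u \<and>
     (\<forall>j\<le>k. set_integrable lborel (hball R)
        (\<lambda>x. tnorm j (\<lambda>is. cov is u x) x powr p * hdens x))"

text \<open>An element of the completion W^{k,p}(B_R), represented by its covariant derivatives
  G j x is = (nabla^j u)_{is}(x), j = 0..k (G 0 x [] = u x), obtained as L^p(dV_g)-limits
  of the covariant derivatives of a sequence of functions from the generating class.\<close>
definition hsobolev :: "nat \<Rightarrow> real \<Rightarrow> ereal \<Rightarrow> (nat \<Rightarrow> 'a::euclidean_space \<Rightarrow> 'a list \<Rightarrow> real) \<Rightarrow> bool" where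
  "hsobolev k p R G \<longleftrightarrow>
     (\<forall>j\<le>k. \<forall>is. set_borel_measurable lborel (hball R) (\<lambda>x. G j x is)) \<and>
     (\<exists>s. (\<forall>n. hsmooth_class k p R (s n)) \<and>
        (\<forall>j\<le>k. (\<lambda>n. \<integral>\<^sup>+x\<in>hball R. ennreal
             (tnorm j (\<lambda>is. cov is (s n) x - G j x is) x powr p * hdens x) \<partial>lborel)
           \<longlonglongrightarrow> 0))"

definition ival :: "ereal \<Rightarrow> real set" where
  "ival R = {t. 0 < t \<and> ereal t < R}"

definition loc_integrable :: "ereal \<Rightarrow> (real \<Rightarrow> real) \<Rightarrow> bool" where
  "loc_integrable R f \<longleftrightarrow> (\<forall>K. compact K \<and> K \<subseteq> ival R \<longrightarrow> set_integrable lborel K f)"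

definition test_fun :: "ereal \<Rightarrow> (real \<Rightarrow> real) \<Rightarrow> bool" where
  "test_fun R \<phi> \<longleftrightarrow> (\<forall>n x. ((deriv ^^ n) \<phi>) differentiable (at x)) \<and>
     (\<exists>a b. 0 < a \<and> a \<le> b \<and> ereal b < R \<and> (\<forall>t. t \<notin> {a..b} \<longrightarrow> \<phi> t = 0))"

definition weak_deriv :: "ereal \<Rightarrow> (real \<Rightarrow> real) \<Rightarrow> (real \<Rightarrow> real) \<Rightarrow> bool" where
  "weak_deriv R f w \<longleftrightarrow> loc_integrable R f \<and> loc_integrable R w \<and>
     (\<forall>\<phi>. test_fun R \<phi> \<longrightarrow>
        set_lebesgue_integral lborel (ival R) (\<lambda>t. f t * deriv \<phi> t)
        = - set_lebesgue_integral lborel (ival R) (\<lambda>t. w t * \<phi> t))"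

definition wsob_witness :: "nat \<Rightarrow> real \<Rightarrow> ereal \<Rightarrow> nat \<Rightarrow> (real \<Rightarrow> real) \<Rightarrow> (nat \<Rightarrow> real \<Rightarrow> real) \<Rightarrow> bool" where
  "wsob_witness k p R N v w \<longleftrightarrow> w 0 = v \<and>
     (\<forall>j<k. weak_deriv R (w j) (w (Suc j))) \<and>
     (\<forall>j\<le>k. set_integrable lborel (ival R) (\<lambda>t. \<bar>w j t\<bar> powr p * sinh t ^ (N - 1)))"

definition wsobolev :: "nat \<Rightarrow> real \<Rightarrow> ereal \<Rightarrow> nat \<Rightarrow> (real \<Rightarrow> real) \<Rightarrow> bool" where
  "wsobolev k p R N v \<longleftrightarrow> (\<exists>w. wsob_witness k p R N v w)"

end

theory Submission
  imports Defs
begin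

text \<open>
  The ray \<open>t \<mapsto> tanh (t/2) \<theta>\<close> is a unit speed geodesic, so the \<open>j\<close>-th derivative of a smooth \<open>u\<close> along it
  is the full contraction of \<open>\<nabla>\<^sup>j u\<close> with its velocity, which by Cauchy-Schwarz is at most \<open>|\<nabla>\<^sup>j u|\<close>.
  The approximating functions need not be radial. By Fubini and Fatou, on almost every ray some of
  them come arbitrarily close, with all radial derivatives, to the radial contractions of the limit
  tensors. These contractions are therefore the weak derivatives of \<open>v\<close> on almost every ray. As weak
  derivatives are unique, the contractions are radial almost everywhere; one fixed ray supplies them.
\<close>

section \<open>Weak derivatives on an interval\<close>

text \<open>The limit tensors \<open>G\<close> matter only up to null sets, so a ray prescribed in
  advance may be exceptional; this is why the inequality is obtained for almost every point and why
  the ray that supplies the witness has to be chosen. Convergence in L^p on the ball becomes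
  smallness along rays only for indices that may differ from ray to ray and from tolerance to
  tolerance. Derivatives along a ray are therefore handled by \<open>approx_deriv\<close>, which
  asks for some C^1 approximant per tolerance. A liminf equal to 0 supplies exactly this, and no
  subsequence is extracted. The weight \<open>sinh t ^ (N - 1)\<close> is what is left of the volume
  density once rays are parametrised by arc length. It can degenerate as t tends to 0, but weak
  derivatives involve only compact subintervals, where it is bounded below and weighted L^p control
  yields L^1 control.\<close>

lemma set_integrable_mult_continuous:
  fixes f \<phi> :: "real \<Rightarrow> real"
  assumes "set_integrable lborel {a..b} f" "continuous_on {a..b} \<phi>"
  shows "set_integrable lborel {a..b} (\<lambda>t. f t * \<phi> t)"
proof -
  obtain M where M: "\<And>t. t \<in> {a..b} \<Longrightarrow> \<bar>\<phi> t\<bar> \<le> M"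
    using compact_imp_bounded[OF compact_continuous_image[OF assms(2) compact_Icc]]
    unfolding bounded_iff by force
  have [measurable]: "set_borel_measurable lborel {a..b} f"
    using assms(1) unfolding set_integrable_def set_borel_measurable_def by auto
  \<comment> \<open>Neither factor is known to be measurable off the interval, so each one is cut
    off before multiplying.\<close>
  have "(\<lambda>t. (indicator {a..b} t *\<^sub>R f t) * (indicator {a..b} t *\<^sub>R \<phi> t)) \<in> borel_measurable lborel"
    using borel_measurable_continuous_on_indicator[of "{a..b}" \<phi>] assms
    unfolding set_integrable_def by (intro borel_measurable_times) auto
  moreover have "(\<lambda>t. (indicator {a..b} t *\<^sub>R f t) * (indicator {a..b} t *\<^sub>R \<phi> t))
      = (\<lambda>t. indicator {a..b} t *\<^sub>R (f t * \<phi> t))"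
    by (auto simp: indicator_def)
  ultimately have meas: "set_borel_measurable lborel {a..b} (\<lambda>t. f t * \<phi> t)"
    unfolding set_borel_measurable_def by simp
  show ?thesis
  proof (rule set_integrable_bound[OF _ meas])
    show "set_integrable lborel {a..b} (\<lambda>t. M * f t)"
      using assms(1) by (rule set_integrable_mult_right)
    show "AE t in lborel. t \<in> {a..b} \<longrightarrow> norm (f t * \<phi> t) \<le> norm (M * f t)"
    proof (intro AE_I2 impI)
      fix t assume "t \<in> {a..b}"
      then have "\<bar>\<phi> t\<bar> \<le> \<bar>M\<bar>" using M by force
      then show "norm (f t * \<phi> t) \<le> norm (M * f t)"
        by (simp add: abs_mult mult.commute mult_right_mono)
    qed
  qed
qed

lemma set_integrable_Icc_subset:
  fixes f :: "real \<Rightarrow> real"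
  assumes "loc_integrable R f" "0 < a" "ereal b < R"
  shows "set_integrable lborel {a..b} f"
proof -
  have "{a..b} \<subseteq> ival R"
    using assms(2,3) unfolding ival_def
    by auto (metis ereal_less_eq(3) order_le_less_trans)
  then show ?thesis using assms(1) unfolding loc_integrable_def by blast
qed

text \<open>The derivative as an L^1 closure on compact subintervals. This is the form in which the
  smooth approximants deliver it; it implies \<open>weak_deriv\<close>, and its uniqueness needs
  only the fundamental theorem of calculus, no mollification. The pair \<open>F\<close>,
  \<open>F'\<close> may depend on the interval and on \<open>e\<close>. Local integrability also
  guarantees that both integrals are genuine and not the default value 0 of a non-integrable
  function.\<close>

definition approx_deriv :: "ereal \<Rightarrow> (real \<Rightarrow> real) \<Rightarrow> (real \<Rightarrow> real) \<Rightarrow> bool" where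
  "approx_deriv R f g \<longleftrightarrow> loc_integrable R f \<and> loc_integrable R g \<and>
    (\<forall>a b e. 0 < a \<and> a < b \<and> ereal b < R \<and> 0 < e \<longrightarrow>
      (\<exists>F F'. (\<forall>t\<in>{a..b}. (F has_real_derivative F' t) (at t)) \<and> continuous_on {a..b} F' \<and>
        integral {a..b} (\<lambda>t. \<bar>F t - f t\<bar>) < e \<and> integral {a..b} (\<lambda>t. \<bar>F' t - g t\<bar>) < e))"

lemma approx_derivE:
  assumes "approx_deriv R f g" "0 < a" "a < b" "ereal b < R" "0 < e"
  obtains F F' where "\<And>t. t \<in> {a..b} \<Longrightarrow> (F has_real_derivative F' t) (at t)"
    "continuous_on {a..b} F'" "integral {a..b} (\<lambda>t. \<bar>F t - f t\<bar>) < e"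
    "integral {a..b} (\<lambda>t. \<bar>F' t - g t\<bar>) < e"
proof -
  obtain F F' where "(\<forall>t\<in>{a..b}. (F has_real_derivative F' t) (at t)) \<and> continuous_on {a..b} F' \<and>
        integral {a..b} (\<lambda>t. \<bar>F t - f t\<bar>) < e \<and> integral {a..b} (\<lambda>t. \<bar>F' t - g t\<bar>) < e"
    using assms unfolding approx_deriv_def by presburger
  then show ?thesis by (intro that[of F F']) auto
qed

text \<open>For a C^1 pair the integral of F \<phi>' + F' \<phi> vanishes, being the boundary values
  of F \<phi>. Replacing F, F' by f, g costs at most the L^1 errors times a bound for \<phi> and
  \<phi>'.\<close>

lemma approx_deriv_imp_weak_deriv:
  assumes "approx_deriv R f g"
  shows "weak_deriv R f g"
proof -
  have main: "set_lebesgue_integral lborel (ival R) (\<lambda>t. f t * deriv \<phi> t)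
        = - set_lebesgue_integral lborel (ival R) (\<lambda>t. g t * \<phi> t)" if "test_fun R \<phi>" for \<phi>
  proof -
    from that obtain a0 b0 where ab0: "0 < a0" "a0 \<le> b0" "ereal b0 < R"
      and supp: "\<And>t. t \<notin> {a0..b0} \<Longrightarrow> \<phi> t = 0"
      and sm: "\<And>n x. ((deriv ^^ n) \<phi>) differentiable (at x)"
      unfolding test_fun_def by blast
    \<comment> \<open>The interval is enlarged on both sides: \<phi> is only assumed to vanish
      outside \<open>{a0..b0}\<close>, and \<open>a0 = b0\<close> is possible, while
      \<open>approx_deriv\<close> wants \<open>a < b\<close> and the boundary terms must be
      0.\<close>
    obtain b where b: "b0 < b" "ereal b < R"
      using ereal_dense2[OF ab0(3)] by auto
    define a where "a = a0 / 2"
    have a: "0 < a" "a < a0" "a < b" using ab0 b by (auto simp: a_def)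
    have d\<phi>: "(\<phi> has_real_derivative deriv \<phi> t) (at t)" for t
      using sm[of 0 t] by (simp add: DERIV_deriv_iff_real_differentiable)
    have c\<phi>: "continuous_on {a..b} \<phi>"
      by (meson d\<phi> DERIV_isCont continuous_at_imp_continuous_on)
    have cd\<phi>: "continuous_on {a..b} (deriv \<phi>)"
    proof (intro continuous_at_imp_continuous_on ballI)
      fix x show "isCont (deriv \<phi>) x"
        using differentiable_imp_continuous_within[OF sm[of 1 x]] by simp
    qed
    have supp': "deriv \<phi> t = 0" if "t \<notin> {a0..b0}" for t
    proof -
      have "open (- {a0..b0})" by auto
      then have "(\<phi> has_real_derivative 0) (at t)"
        by (rule has_field_derivative_transform_within_open[of "\<lambda>_. 0" 0 t "- {a0..b0}", rotated])
          (use that supp in auto)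
      then show ?thesis by (rule DERIV_imp_deriv)
    qed
    have sub: "{a..b} \<subseteq> ival R"
      using a b unfolding ival_def by auto (metis ereal_less_eq(3) order_le_less_trans)
    have in0: "t \<in> {a..b} \<and> t \<in> ival R" if "t \<in> {a0..b0}" for t
    proof -
      have "t \<in> {a..b}" using that a b by simp
      then show ?thesis using sub by blast
    qed
    have intf: "set_integrable lborel {a..b} f" and intg: "set_integrable lborel {a..b} g"
      using assms a b unfolding approx_deriv_def by (auto intro!: set_integrable_Icc_subset)
    have i1: "set_integrable lborel {a..b} (\<lambda>t. f t * deriv \<phi> t)"
      and i2: "set_integrable lborel {a..b} (\<lambda>t. g t * \<phi> t)"
      using intf intg c\<phi> cd\<phi> by (auto intro!: set_integrable_mult_continuous)
    have e1: "set_lebesgue_integral lborel (ival R) (\<lambda>t. f t * deriv \<phi> t)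
      = integral {a..b} (\<lambda>t. f t * deriv \<phi> t)"
    proof -
      have "indicator (ival R) t *\<^sub>R (f t * deriv \<phi> t) = indicator {a..b} t *\<^sub>R (f t * deriv \<phi> t)" for t
        using supp'[of t] in0[of t] by (cases "t \<in> {a0..b0}") (simp_all add: indicator_def)
      then show ?thesis
        using set_borel_integral_eq_integral(2)[OF i1] unfolding set_lebesgue_integral_def by (simp only:)
    qed
    have e2: "set_lebesgue_integral lborel (ival R) (\<lambda>t. g t * \<phi> t)
      = integral {a..b} (\<lambda>t. g t * \<phi> t)"
    proof -
      have "indicator (ival R) t *\<^sub>R (g t * \<phi> t) = indicator {a..b} t *\<^sub>R (g t * \<phi> t)" for t
        using supp[of t] in0[of t] by (cases "t \<in> {a0..b0}") (simp_all add: indicator_def)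
      then show ?thesis
        using set_borel_integral_eq_integral(2)[OF i2] unfolding set_lebesgue_integral_def by (simp only:)
    qed
    obtain M1 where M1: "\<And>t. t \<in> {a..b} \<Longrightarrow> \<bar>\<phi> t\<bar> \<le> M1"
      using compact_imp_bounded[OF compact_continuous_image[OF c\<phi> compact_Icc]]
      unfolding bounded_iff by force
    obtain M2 where M2: "\<And>t. t \<in> {a..b} \<Longrightarrow> \<bar>deriv \<phi> t\<bar> \<le> M2"
      using compact_imp_bounded[OF compact_continuous_image[OF cd\<phi> compact_Icc]]
      unfolding bounded_iff by force
    define M where "M = max (max M1 M2) 1"
    have M: "\<bar>\<phi> t\<bar> \<le> M" "\<bar>deriv \<phi> t\<bar> \<le> M" if "t \<in> {a..b}" for t
      using M1[OF that] M2[OF that] by (auto simp: M_def)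
    have "M > 0" by (auto simp: M_def)
    let ?D = "integral {a..b} (\<lambda>t. f t * deriv \<phi> t) + integral {a..b} (\<lambda>t. g t * \<phi> t)"
    have bnd: "\<bar>?D\<bar> \<le> 2 * M * e" if "e > 0" for e
    proof -
      obtain F F' where F: "\<And>t. t \<in> {a..b} \<Longrightarrow> (F has_real_derivative F' t) (at t)"
        and cF': "continuous_on {a..b} F'"
        and lt1: "integral {a..b} (\<lambda>t. \<bar>F t - f t\<bar>) < e"
        and lt2: "integral {a..b} (\<lambda>t. \<bar>F' t - g t\<bar>) < e"
        by (rule approx_derivE[OF assms a(1,3) b(2) \<open>e > 0\<close>]) auto
      have cF: "continuous_on {a..b} F"
        by (meson F DERIV_isCont continuous_at_imp_continuous_on)
      have iF: "set_integrable lborel {a..b} F" "set_integrable lborel {a..b} F'"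
        using cF cF' by (auto intro: borel_integrable_atLeastAtMost')
      have d1: "set_integrable lborel {a..b} (\<lambda>t. F t - f t)"
        and d2: "set_integrable lborel {a..b} (\<lambda>t. F' t - g t)"
        using iF intf intg by (auto intro: set_integral_diff)
      have m1: "(\<lambda>t. (F t - f t) * deriv \<phi> t) integrable_on {a..b}"
        and m2: "(\<lambda>t. (F' t - g t) * \<phi> t) integrable_on {a..b}"
        using set_integrable_mult_continuous[OF d1 cd\<phi>] set_integrable_mult_continuous[OF d2 c\<phi>]
        by (auto dest: set_borel_integral_eq_integral(1))
      have n1: "(\<lambda>t. \<bar>F t - f t\<bar>) integrable_on {a..b}" and n2: "(\<lambda>t. \<bar>F' t - g t\<bar>) integrable_on {a..b}"
        using set_integrable_abs[OF d1] set_integrable_abs[OF d2]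
        by (auto dest: set_borel_integral_eq_integral(1))
      have "((\<lambda>t. F t * deriv \<phi> t + F' t * \<phi> t) has_integral (F b * \<phi> b - F a * \<phi> a)) {a..b}"
      proof (rule fundamental_theorem_of_calculus)
        show "a \<le> b" using a by simp
        fix t assume t: "t \<in> {a..b}"
        have "((\<lambda>t. F t * \<phi> t) has_real_derivative (F t * deriv \<phi> t + F' t * \<phi> t)) (at t)"
          using DERIV_mult[OF F[OF t] d\<phi>[of t]] by (simp add: algebra_simps)
        then show "((\<lambda>t. F t * \<phi> t) has_vector_derivative (F t * deriv \<phi> t + F' t * \<phi> t)) (at t within {a..b})"
          by (simp add: has_real_derivative_iff_has_vector_derivative has_vector_derivative_at_within)
      qed
      moreover have "\<phi> a = 0" "\<phi> b = 0" using supp a b by auto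
      ultimately have z: "((\<lambda>t. F t * deriv \<phi> t + F' t * \<phi> t) has_integral 0) {a..b}" by simp
      have "((\<lambda>t. F t * deriv \<phi> t + F' t * \<phi> t - ((F t - f t) * deriv \<phi> t + (F' t - g t) * \<phi> t)) has_integral
        (0 - (integral {a..b} (\<lambda>t. (F t - f t) * deriv \<phi> t) + integral {a..b} (\<lambda>t. (F' t - g t) * \<phi> t)))) {a..b}"
        using m1 m2 by (intro has_integral_diff z has_integral_add) (auto simp: has_integral_integral)
      moreover have "(\<lambda>t. F t * deriv \<phi> t + F' t * \<phi> t - ((F t - f t) * deriv \<phi> t + (F' t - g t) * \<phi> t))
         = (\<lambda>t. f t * deriv \<phi> t + g t * \<phi> t)"
        by (auto simp: algebra_simps)
      moreover have "integral {a..b} (\<lambda>t. f t * deriv \<phi> t + g t * \<phi> t) = ?D"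
        using i1 i2 by (intro integral_add) (auto dest: set_borel_integral_eq_integral(1))
      ultimately have D: "?D = - integral {a..b} (\<lambda>t. (F t - f t) * deriv \<phi> t) - integral {a..b} (\<lambda>t. (F' t - g t) * \<phi> t)"
        by (simp add: integral_unique)
      have "\<bar>integral {a..b} (\<lambda>t. (F t - f t) * deriv \<phi> t)\<bar> \<le> integral {a..b} (\<lambda>t. M * \<bar>F t - f t\<bar>)"
        using integral_norm_bound_integral[OF m1 integrable_on_mult_right[OF n1, of M]] M(2)
        by (simp add: abs_mult mult.commute mult_right_mono)
      also have "\<dots> \<le> M * e" using lt1 \<open>M > 0\<close> by simp
      finally have b1: "\<bar>integral {a..b} (\<lambda>t. (F t - f t) * deriv \<phi> t)\<bar> \<le> M * e" .
      have "\<bar>integral {a..b} (\<lambda>t. (F' t - g t) * \<phi> t)\<bar> \<le> integral {a..b} (\<lambda>t. M * \<bar>F' t - g t\<bar>)"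
        using integral_norm_bound_integral[OF m2 integrable_on_mult_right[OF n2, of M]] M(1)
        by (simp add: abs_mult mult.commute mult_right_mono)
      also have "\<dots> \<le> M * e" using lt2 \<open>M > 0\<close> by simp
      finally show ?thesis using b1 D by linarith
    qed
    have "?D = 0"
    proof (rule ccontr)
      assume "?D \<noteq> 0"
      then have "\<bar>?D\<bar> > 0" by simp
      \<comment> \<open>This tolerance makes the right side half of the left side.\<close>
      then have "\<bar>?D\<bar> \<le> 2 * M * (\<bar>?D\<bar> / (4 * M))" using \<open>M > 0\<close> by (intro bnd) simp
      then show False using \<open>\<bar>?D\<bar> > 0\<close> \<open>M > 0\<close> by (simp add: field_simps)
    qed
    then show ?thesis using e1 e2 by linarith
  qed
  show ?thesis using assms main unfolding weak_deriv_def approx_deriv_def by blast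
qed

text \<open>Lebesgue differentiation: almost everywhere g is the limit of its averages over short
  intervals to the right of the point, and these are differences of vanishing primitives.\<close>

lemma AE_zero_if_integral_zero:
  fixes g :: "real \<Rightarrow> real"
  assumes int: "set_integrable lborel {a..b} g"
    and zero: "\<And>x. x \<in> {a..b} \<Longrightarrow> integral {a..x} g = 0"
  shows "AE t in lborel. t \<in> {a<..<b} \<longrightarrow> g t = 0"
proof -
  \<comment> \<open>Extension by 0, because the differentiation theorem wants integrability on every
    box.\<close>
  define h where "h = (\<lambda>t. if t \<in> {a..b} then g t else 0)"
  have "h integrable_on UNIV"
    unfolding h_def using set_borel_integral_eq_integral(1)[OF int] by (simp only: integrable_restrict_UNIV)
  then have "h integrable_on cbox c d" for c d
    by (rule integrable_on_subcbox) auto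
  then obtain N where N: "negligible N" and 
    lim: "\<And>x e. \<lbrakk>x \<notin> N; 0 < e\<rbrakk> \<Longrightarrow>
       \<exists>d>0. \<forall>s. 0 < s \<and> s < d \<longrightarrow> norm (integral (cbox x (x + s *\<^sub>R One)) h /\<^sub>R s ^ DIM(real) - h x) < e"
    using integrable_ccontinuous_explicit[of h] by blast
  have gz: "g t = 0" if t: "t \<in> {a<..<b}" "t \<notin> N" for t
  proof (rule ccontr)
    assume "g t \<noteq> 0"
    then obtain d where d: "d > 0" 
      and dl: "\<And>s. 0 < s \<Longrightarrow> s < d \<Longrightarrow> norm (integral (cbox t (t + s *\<^sub>R One)) h /\<^sub>R s ^ DIM(real) - h t) < \<bar>g t\<bar>"
      using lim[OF t(2), of "\<bar>g t\<bar>"] by auto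
    define s where "s = min (d / 2) (b - t)"
    have s: "0 < s" "s < d" "t + s \<le> b" using d t by (auto simp: s_def)
    have "integral {t..t+s} h = integral {t..t+s} g"
      using t s by (intro integral_cong) (auto simp: h_def)
    also have "\<dots> = integral {a..t+s} g - integral {a..t} g"
    proof -
      have "g integrable_on {a..t+s}"
        using set_borel_integral_eq_integral(1)[OF int] s
        by (rule_tac integrable_on_subinterval) auto
      from Henstock_Kurzweil_Integration.integral_combine[OF _ _ this, of t] t s show ?thesis by simp
    qed
    also have "\<dots> = 0" using zero[of t] zero[of "t+s"] t s by simp
    finally have "integral (cbox t (t + s *\<^sub>R One)) h = 0" by simp
    then show False using dl[OF s(1,2)] t by (simp add: h_def)
  qed
  have "N \<in> null_sets lebesgue" using N negligible_iff_null_sets by blast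
  then have "AE t in lebesgue. t \<notin> N" by (rule AE_not_in)
  then have "AE t in lborel. t \<notin> N" by (simp add: AE_completion_iff)
  then show ?thesis using gz by auto
qed

text \<open>A primitive of \<open>g1 - g2\<close> is an \<open>L\<^sup>1\<close>-limit of constants, hence constant.\<close>

lemma approx_deriv_unique_Icc:
  assumes "approx_deriv R f1 g1" "approx_deriv R f2 g2"
    and eq: "AE t in lborel. t \<in> ival R \<longrightarrow> f1 t = f2 t"
    and ab: "0 < a" "a < b" "ereal b < R"
  shows "AE t in lborel. t \<in> {a<..<b} \<longrightarrow> g1 t = g2 t"
proof -
  have int: "set_integrable lborel {a..b} f1" "set_integrable lborel {a..b} f2"
    "set_integrable lborel {a..b} g1" "set_integrable lborel {a..b} g2"
    using assms unfolding approx_deriv_def by (auto intro!: set_integrable_Icc_subset)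
  define g where "g t = g1 t - g2 t" for t
  have intg: "set_integrable lborel {a..b} g"
    unfolding g_def using int by (auto intro: set_integral_diff)
  note gi = set_borel_integral_eq_integral(1)[OF intg]
  define Q where "Q x = integral {a..x} g" for x
  have cQ: "continuous_on {a..b} Q"
    unfolding Q_def by (rule indefinite_integral_continuous_1[OF gi])
  have sub: "{a..b} \<subseteq> ival R"
    using ab unfolding ival_def by auto (metis ereal_less_eq(3) order_le_less_trans)
  have approx: "\<exists>c. integral {a..b} (\<lambda>x. \<bar>Q x - c\<bar>) \<le> e" if "e > 0" for e
  proof -
    \<comment> \<open>Chosen for the total error at the end: \<open>2 * e' * (b - a)\<close> from a
      uniform bound and \<open>2 * e'\<close> from the L^1 norm of \<open>d\<close>.\<close>
    define e' where "e' = e / (2 * (b - a) + 2)"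
    have e': "e' > 0" using that ab by (simp add: e'_def)
    obtain F1 F1' where F1: "\<And>t. t \<in> {a..b} \<Longrightarrow> (F1 has_real_derivative F1' t) (at t)"
      and cF1': "continuous_on {a..b} F1'"
      and lt1: "integral {a..b} (\<lambda>t. \<bar>F1 t - f1 t\<bar>) < e'"
      and lt1': "integral {a..b} (\<lambda>t. \<bar>F1' t - g1 t\<bar>) < e'"
      by (rule approx_derivE[OF assms(1) ab e']) auto
    obtain F2 F2' where F2: "\<And>t. t \<in> {a..b} \<Longrightarrow> (F2 has_real_derivative F2' t) (at t)"
      and cF2': "continuous_on {a..b} F2'"
      and lt2: "integral {a..b} (\<lambda>t. \<bar>F2 t - f2 t\<bar>) < e'"
      and lt2': "integral {a..b} (\<lambda>t. \<bar>F2' t - g2 t\<bar>) < e'"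
      by (rule approx_derivE[OF assms(2) ab e']) auto
    have cF: "continuous_on {a..b} F1" "continuous_on {a..b} F2"
      by (meson F1 F2 DERIV_isCont continuous_at_imp_continuous_on)+
    have iF: "set_integrable lborel {a..b} F1" "set_integrable lborel {a..b} F1'"
        "set_integrable lborel {a..b} F2" "set_integrable lborel {a..b} F2'"
      using cF cF1' cF2' by (auto intro: borel_integrable_atLeastAtMost')
    define d where "d t = F1 t - F2 t" for t
    define d' where "d' t = F1' t - F2' t" for t
    have dd: "(d has_real_derivative d' t) (at t)" if "t \<in> {a..b}" for t
      unfolding d_def d'_def using F1[OF that] F2[OF that] by (rule DERIV_diff)
    have cd: "continuous_on {a..b} d"
      unfolding d_def using cF by (intro continuous_intros)
    have cd': "continuous_on {a..b} d'"
      unfolding d'_def using cF1' cF2' by (intro continuous_intros)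
    have A: "(\<lambda>t. \<bar>F1 t - f1 t\<bar>) integrable_on {a..b}" "(\<lambda>t. \<bar>F2 t - f2 t\<bar>) integrable_on {a..b}"
       "(\<lambda>t. \<bar>F1' t - g1 t\<bar>) integrable_on {a..b}" "(\<lambda>t. \<bar>F2' t - g2 t\<bar>) integrable_on {a..b}"
      "(\<lambda>t. \<bar>d' t - g t\<bar>) integrable_on {a..b}"
      using int iF intg borel_integrable_atLeastAtMost'[OF cd']
      by (auto intro!: set_borel_integral_eq_integral(1) set_integrable_abs set_integral_diff)
    have id: "(\<lambda>t. \<bar>d t\<bar>) integrable_on {a..b}"
      using cd by (intro integrable_continuous_real continuous_intros)
    have "integral {a..b} (\<lambda>t. \<bar>d t\<bar>) \<le> integral {a..b} (\<lambda>t. \<bar>F1 t - f1 t\<bar> + \<bar>F2 t - f2 t\<bar>)"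
    proof -
      \<comment> \<open>\<open>f1\<close> and \<open>f2\<close> cancel only off a null set, which
        the gauge integral ignores as a negligible set.\<close>
      obtain N where N: "{t \<in> space lborel. \<not> (t \<in> ival R \<longrightarrow> f1 t = f2 t)} \<subseteq> N"
        "emeasure lborel N = 0" "N \<in> sets lborel"
        using AE_E[OF eq] by metis
      have "negligible N"
        using N(2,3) by (simp add: negligible_iff_null_sets null_sets_completionI null_setsI)
      have "integral {a..b} (\<lambda>t. \<bar>d t\<bar>) = integral {a..b} (\<lambda>t. \<bar>(F1 t - f1 t) - (F2 t - f2 t)\<bar>)"
        using sub N(1) by (intro integral_spike[OF \<open>negligible N\<close>]) (auto simp: d_def subset_iff)
      also have "\<dots> \<le> integral {a..b} (\<lambda>t. \<bar>F1 t - f1 t\<bar> + \<bar>F2 t - f2 t\<bar>)"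
        using A(1,2) int iF
        by (intro integral_le integrable_add set_borel_integral_eq_integral(1) set_integrable_abs set_integral_diff) auto
      finally show ?thesis .
    qed
    also have "\<dots> \<le> 2 * e'" using A lt1 lt2 by (subst integral_add) auto
    finally have D: "integral {a..b} (\<lambda>t. \<bar>d t\<bar>) \<le> 2 * e'" .
    have "integral {a..b} (\<lambda>t. \<bar>d' t - g t\<bar>) \<le> integral {a..b} (\<lambda>t. \<bar>F1' t - g1 t\<bar> + \<bar>F2' t - g2 t\<bar>)"
      using A by (intro integral_le integrable_add) (auto simp: d'_def g_def)
    also have "\<dots> \<le> 2 * e'" using A lt1' lt2' by (subst integral_add) auto
    finally have D': "integral {a..b} (\<lambda>t. \<bar>d' t - g t\<bar>) \<le> 2 * e'" .
    \<comment> \<open>Integrating \<open>d' - g\<close> from \<open>a\<close> compares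
      \<open>Q\<close> uniformly with \<open>d - d a\<close>. Since \<open>d\<close> itself is small
      in L^1, \<open>Q\<close> is L^1-close to the constant \<open>- d a\<close>.\<close>
    have pw: "\<bar>d x - d a - Q x\<bar> \<le> 2 * e'" if x: "x \<in> {a..b}" for x
    proof -
      have "(d' has_integral (d x - d a)) {a..x}"
        using x dd by (intro fundamental_theorem_of_calculus)
          (auto simp: has_real_derivative_iff_has_vector_derivative[symmetric] intro: has_field_derivative_at_within)
      moreover have gx: "g integrable_on {a..x}" 
        using gi x by (rule_tac integrable_on_subinterval) auto
      ultimately have hi: "((\<lambda>t. d' t - g t) has_integral (d x - d a - Q x)) {a..x}"
        unfolding Q_def by (intro has_integral_diff) (auto simp: has_integral_integral)
      have ax: "(\<lambda>t. \<bar>d' t - g t\<bar>) integrable_on {a..x}"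
        using A(5) x by (rule_tac integrable_on_subinterval) auto
      have "\<bar>d x - d a - Q x\<bar> \<le> integral {a..x} (\<lambda>t. \<bar>d' t - g t\<bar>)"
        using integral_norm_bound_integral[OF has_integral_integrable[OF hi] ax]
        unfolding integral_unique[OF hi] by simp
      also have "\<dots> \<le> integral {a..b} (\<lambda>t. \<bar>d' t - g t\<bar>)"
        using ax A(5) x by (intro integral_subset_le) auto
      finally show ?thesis using D' by simp
    qed
    have "integral {a..b} (\<lambda>x. \<bar>Q x - (- d a)\<bar>) \<le> integral {a..b} (\<lambda>x. 2 * e' + \<bar>d x\<bar>)"
    proof (rule integral_le)
      show "(\<lambda>x. \<bar>Q x - (- d a)\<bar>) integrable_on {a..b}"
        using cQ by (intro integrable_continuous_real continuous_intros)
      show "(\<lambda>x. 2 * e' + \<bar>d x\<bar>) integrable_on {a..b}"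
        using cd by (intro integrable_continuous_real continuous_intros)
      show "\<bar>Q x - (- d a)\<bar> \<le> 2 * e' + \<bar>d x\<bar>" if "x \<in> {a..b}" for x
        using pw[OF that] by linarith
    qed
    also have "\<dots> = 2 * e' * (b - a) + integral {a..b} (\<lambda>t. \<bar>d t\<bar>)"
      using id ab by (subst integral_add) auto
    also have "\<dots> \<le> 2 * e' * (b - a) + 2 * e'" using D by simp
    also have "\<dots> = (2 * (b - a) + 2) * e'" by (simp add: algebra_simps)
    also have "\<dots> = e" using ab by (simp add: e'_def)
    finally show ?thesis by blast
  qed
  \<comment> \<open>The approximating constants vary with the tolerance. The mean of
    \<open>Q\<close> is one fixed constant, and it is at most twice as far from \<open>Q\<close> in
    L^1 as any other constant.\<close>
  define m where "m = integral {a..b} Q / (b - a)"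
  have "integral {a..b} (\<lambda>x. \<bar>Q x - m\<bar>) \<le> 2 * e" if e: "e > 0" for e
  proof -
    obtain c where c: "integral {a..b} (\<lambda>x. \<bar>Q x - c\<bar>) \<le> e" using approx[OF e] by blast
    have iQ: "(\<lambda>x. \<bar>Q x - c\<bar>) integrable_on {a..b}" "Q integrable_on {a..b}"
      "(\<lambda>x. \<bar>Q x - m\<bar>) integrable_on {a..b}" "(\<lambda>x. Q x - c) integrable_on {a..b}"
      using cQ by (auto intro!: integrable_continuous_real continuous_intros)
    have "(m - c) * (b - a) = integral {a..b} (\<lambda>x. Q x - c)"
      using ab iQ by (subst integral_diff) (auto simp: m_def field_simps)
    also have "\<bar>\<dots>\<bar> \<le> integral {a..b} (\<lambda>x. \<bar>Q x - c\<bar>)"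
      using integral_norm_bound_integral[OF iQ(4,1)] by simp
    finally have mc: "\<bar>m - c\<bar> * (b - a) \<le> e" using c ab by (simp add: abs_mult)
    have "integral {a..b} (\<lambda>x. \<bar>Q x - m\<bar>) \<le> integral {a..b} (\<lambda>x. \<bar>Q x - c\<bar> + \<bar>m - c\<bar>)"
      using iQ by (intro integral_le integrable_add) auto
    also have "\<dots> = integral {a..b} (\<lambda>x. \<bar>Q x - c\<bar>) + \<bar>m - c\<bar> * (b - a)"
      using iQ ab by (subst integral_add) auto
    finally show ?thesis using mc c by linarith
  qed
  then have "integral {a..b} (\<lambda>x. \<bar>Q x - m\<bar>) \<le> 0 + e" if "e > 0" for e
    using that by (metis add_0 field_sum_of_halves half_gt_zero mult_2)
  then have "integral {a..b} (\<lambda>x. \<bar>Q x - m\<bar>) \<le> 0" by (rule field_le_epsilon)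
  moreover have "integral {a..b} (\<lambda>x. \<bar>Q x - m\<bar>) \<ge> 0" 
    using cQ by (intro integral_nonneg integrable_continuous_real continuous_intros) auto
  ultimately have "integral {a..b} (\<lambda>x. \<bar>Q x - m\<bar>) = 0" by simp
  then have Qm: "Q x = m" if "x \<in> {a..b}" for x
  proof -
    have "continuous_on {a..b} (\<lambda>x. \<bar>Q x - m\<bar>)" using cQ by (intro continuous_intros)
    from integral_eq_0_iff[OF this ab(2)] that show ?thesis
      using \<open>integral {a..b} (\<lambda>x. \<bar>Q x - m\<bar>) = 0\<close> by simp
  qed
  have "Q a = 0" by (simp add: Q_def)
  then have "Q x = 0" if "x \<in> {a..b}" for x using Qm[OF that] Qm[of a] ab by simp
  then have "AE t in lborel. t \<in> {a<..<b} \<longrightarrow> g t = 0"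
    unfolding Q_def by (intro AE_zero_if_integral_zero[OF intg]) auto
  then show ?thesis by (auto simp: g_def)
qed

text \<open>Countably many intervals with rational end points exhaust \<open>ival R\<close>, also
  for infinite \<open>R\<close>, so the exceptional null sets can be united.\<close>

lemma approx_deriv_unique:
  assumes "approx_deriv R f1 g1" "approx_deriv R f2 g2"
    and "AE t in lborel. t \<in> ival R \<longrightarrow> f1 t = f2 t"
  shows "AE t in lborel. t \<in> ival R \<longrightarrow> g1 t = g2 t"
proof -
  have "AE t in lborel. \<forall>q :: rat \<times> rat.
    0 < fst q \<and> fst q < snd q \<and> ereal (of_rat (snd q)) < R \<longrightarrow>
    t \<in> {of_rat (fst q)<..<of_rat (snd q)} \<longrightarrow> g1 t = g2 t"
  proof (subst AE_all_countable, intro allI)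
    fix q :: "rat \<times> rat"
    show "AE t in lborel. 0 < fst q \<and> fst q < snd q \<and> ereal (of_rat (snd q)) < R \<longrightarrow>
      t \<in> {of_rat (fst q)<..<of_rat (snd q)} \<longrightarrow> g1 t = g2 t"
    proof (cases "0 < fst q \<and> fst q < snd q \<and> ereal (of_rat (snd q)) < R")
      case True
      then have "AE t in lborel. t \<in> {of_rat (fst q)<..<of_rat (snd q)} \<longrightarrow> g1 t = g2 t"
        by (intro approx_deriv_unique_Icc[OF assms]) (auto simp: of_rat_less)
      then show ?thesis by (rule AE_mp) (intro AE_I2 impI, blast)
    next
      case False
      then show ?thesis by (intro AE_I2 impI) blast
    qed
  qed
  then show ?thesis
  proof (rule AE_mp, intro AE_I2 impI)
    fix t assume H: "\<forall>q :: rat \<times> rat.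
      0 < fst q \<and> fst q < snd q \<and> ereal (of_rat (snd q)) < R \<longrightarrow>
      t \<in> {of_rat (fst q)<..<of_rat (snd q)} \<longrightarrow> g1 t = g2 t" and t: "t \<in> ival R"
    obtain q1 where q1: "0 < q1" "of_rat q1 < t"
      using of_rat_dense[of 0 t] t by (auto simp: ival_def)
    obtain z where z: "t < z" "ereal z < R"
      using ereal_dense2[of t R] t by (auto simp: ival_def)
    obtain q2 where q2: "t < of_rat q2" "of_rat q2 < z"
      using of_rat_dense[of t z] z by auto
    have "(of_rat q1 :: real) < of_rat q2" using q1 q2 by simp
    then have "q1 < q2" by (simp add: of_rat_less)
    moreover have "ereal (of_rat q2) < R"
      using q2 z(2) by (metis less_ereal.simps(1) order.strict_trans)
    ultimately show "g1 t = g2 t" using H[rule_format, of "(q1, q2)"] q1 q2 by simp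
  qed
qed

section \<open>Covariant derivatives along geodesic rays\<close>

text \<open>Unlike \<open>pderivs\<close>, which adds derivatives on the outside, this recursion
  takes the innermost derivative first, so the Leibniz rule can be proved by induction on the order.
  Level \<open>n\<close> means differentiable n + 1 times.\<close>

fun diff_upto :: "nat \<Rightarrow> 'a::euclidean_space set \<Rightarrow> ('a \<Rightarrow> real) \<Rightarrow> bool" where
  "diff_upto 0 S f \<longleftrightarrow> f differentiable_on S"
| "diff_upto (Suc n) S f \<longleftrightarrow> f differentiable_on S \<and>
     (\<forall>i\<in>Basis. diff_upto n S (\<lambda>x. frechet_derivative f (at x) i))"

lemma diff_upto_Suc_imp: "diff_upto (Suc n) S f \<Longrightarrow> diff_upto n S f"
proof (induction n arbitrary: f)
  case (Suc n)
  then show ?case by (metis diff_upto.simps(2))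
qed auto

text \<open>\<open>frechet_derivative\<close> chooses among the maps satisfying
  \<open>has_derivative\<close>. Functions equal near x have the same such maps, so the choices
  agree even where no derivative exists.\<close>

lemma frechet_derivative_cong_open:
  assumes "open S" "x \<in> S" "\<And>y. y \<in> S \<Longrightarrow> f y = g y"
  shows "frechet_derivative f (at x) = frechet_derivative g (at x)"
proof -
  have "(f has_derivative D) (at x) \<longleftrightarrow> (g has_derivative D) (at x)" for D
    using assms has_derivative_transform_within_open[of f D x UNIV S g]
      has_derivative_transform_within_open[of g D x UNIV S f] by auto
  then show ?thesis unfolding frechet_derivative_def by simp
qed

lemma differentiable_on_cong_iff:
  assumes "\<And>x. x \<in> S \<Longrightarrow> f x = g x"
  shows "f differentiable_on S \<longleftrightarrow> g differentiable_on S"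
proof -
  have "(f has_derivative D) (at x within S) \<longleftrightarrow> (g has_derivative D) (at x within S)"
    if "x \<in> S" for x D
    using has_derivative_transform[OF that, of g f] has_derivative_transform[OF that, of f g] assms
    by metis
  then show ?thesis unfolding differentiable_on_def differentiable_def by simp
qed

text \<open>Closed formulas for derivatives hold only inside the open set; this allows substituting
  them at every order.\<close>

lemma diff_upto_cong:
  assumes "open S" "\<And>x. x \<in> S \<Longrightarrow> f x = g x"
  shows "diff_upto n S f \<longleftrightarrow> diff_upto n S g"
  using assms(2)
proof (induction n arbitrary: f g)
  case 0
  show ?case using differentiable_on_cong_iff[of S f g, OF 0] by simp
next
  case (Suc n)
  have "f differentiable_on S \<longleftrightarrow> g differentiable_on S"
    by (rule differentiable_on_cong_iff[of S f g, OF Suc.prems])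
  moreover have "diff_upto n S (\<lambda>x. frechet_derivative f (at x) i)
      \<longleftrightarrow> diff_upto n S (\<lambda>x. frechet_derivative g (at x) i)" for i
    by (rule Suc.IH, rule fun_cong[OF frechet_derivative_cong_open[of S _ f g, OF assms(1) _ Suc.prems]])
  ultimately show ?case by simp
qed

lemma differentiable_onD_open:
  assumes "f differentiable_on S" "open S" "x \<in> S"
  shows "f differentiable (at x)"
  using assms at_within_open[OF assms(3,2)] unfolding differentiable_on_def by metis

lemma diff_upto_const: "diff_upto n S (\<lambda>x. c)"
  by (induction n arbitrary: c) (auto simp: frechet_derivative_const)

lemma diff_upto_inner: "diff_upto n S (\<lambda>x. x \<bullet> i)"
proof -
  have d: "((\<lambda>x. x \<bullet> i) has_derivative (\<lambda>h. h \<bullet> i)) (at x within T)" for x :: 'a and T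
    by (auto intro!: derivative_eq_intros)
  have "frechet_derivative (\<lambda>x. x \<bullet> i) (at x) = (\<lambda>h. h \<bullet> i)" for x :: 'a
    using frechet_derivative_at[OF d] by simp
  moreover have "(\<lambda>x. x \<bullet> i) differentiable_on S"
    unfolding differentiable_on_def differentiable_def using d by blast
  ultimately show ?thesis by (cases n) (simp_all add: diff_upto_const)
qed

lemma diff_upto_add:
  assumes "open S" "diff_upto n S f" "diff_upto n S g"
  shows "diff_upto n S (\<lambda>x. f x + g x)"
  using assms(2,3)
proof (induction n arbitrary: f g)
  case 0
  then show ?case by (auto intro: differentiable_on_add)
next
  case (Suc n)
  have "diff_upto n S (\<lambda>x. frechet_derivative (\<lambda>x. f x + g x) (at x) i)" if i: "i \<in> Basis" for i
  proof (subst diff_upto_cong[OF assms(1)])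
    show "frechet_derivative (\<lambda>x. f x + g x) (at x) i
        = frechet_derivative f (at x) i + frechet_derivative g (at x) i" if "x \<in> S" for x
    proof -
      have "(f has_derivative frechet_derivative f (at x)) (at x)"
        "(g has_derivative frechet_derivative g (at x)) (at x)"
        using Suc.prems differentiable_onD_open[OF _ assms(1) that] frechet_derivative_works by auto
      from has_derivative_add[OF this] show ?thesis
        by (simp add: frechet_derivative_at[symmetric])
    qed
    show "diff_upto n S (\<lambda>x. frechet_derivative f (at x) i + frechet_derivative g (at x) i)"
      using Suc i by auto
  qed
  then show ?case using Suc.prems by (auto intro: differentiable_on_add)
qed

text \<open>Each term of the Leibniz rule keeps one factor undifferentiated;
  \<open>diff_upto_Suc_imp\<close> lowers it to the order of the induction hypothesis.\<close>

lemma diff_upto_mult: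
  assumes "open S" "diff_upto n S f" "diff_upto n S g"
  shows "diff_upto n S (\<lambda>x. f x * g x)"
  using assms(2,3)
proof (induction n arbitrary: f g)
  case 0
  then show ?case by (auto intro: differentiable_on_mult)
next
  case (Suc n)
  have "diff_upto n S (\<lambda>x. frechet_derivative (\<lambda>x. f x * g x) (at x) i)" if i: "i \<in> Basis" for i
  proof (subst diff_upto_cong[OF assms(1)])
    show "frechet_derivative (\<lambda>x. f x * g x) (at x) i
        = f x * frechet_derivative g (at x) i + frechet_derivative f (at x) i * g x" if x: "x \<in> S" for x
    proof -
      have "(f has_derivative frechet_derivative f (at x)) (at x)"
        "(g has_derivative frechet_derivative g (at x)) (at x)"
        using Suc.prems differentiable_onD_open[OF _ assms(1) x] frechet_derivative_works by auto
      from has_derivative_mult[OF this] show ?thesis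
        by (simp add: frechet_derivative_at[symmetric])
    qed
    show "diff_upto n S (\<lambda>x. f x * frechet_derivative g (at x) i + frechet_derivative f (at x) i * g x)"
      using Suc.prems i
      by (intro diff_upto_add[OF assms(1)] Suc.IH diff_upto_Suc_imp[OF Suc.prems(1)]
          diff_upto_Suc_imp[OF Suc.prems(2)]) auto
  qed
  then show ?case using Suc.prems by (auto intro: differentiable_on_mult)
qed

lemma diff_upto_sum:
  assumes "open S" "\<And>i. i \<in> I \<Longrightarrow> diff_upto n S (f i)"
  shows "diff_upto n S (\<lambda>x. \<Sum>i\<in>I. f i x)"
  using assms(2)
proof (induction I rule: infinite_finite_induct)
  case (insert a I)
  then show ?case by (simp del: diff_upto.simps add: diff_upto_add[OF assms(1)])
qed (simp_all add: diff_upto_const)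

lemma diff_upto_diff:
  assumes "open S" "diff_upto n S f" "diff_upto n S g"
  shows "diff_upto n S (\<lambda>x. f x - g x)"
proof -
  have "diff_upto n S (\<lambda>x. f x + (- 1) * g x)"
    by (intro diff_upto_add diff_upto_mult diff_upto_const assms)
  then show ?thesis by simp
qed

lemma has_derivative_hconf:
  fixes x :: "'a::euclidean_space"
  assumes "norm x < 1"
  shows "(hconf has_derivative (\<lambda>h. hconf x * hconf x * (x \<bullet> h))) (at x)"
proof -
  have "x \<bullet> x < 1"
    using assms by (metis norm_eq_sqrt_inner real_sqrt_lt_1_iff)
  then have "((\<lambda>x::'a. 2 / (1 - x \<bullet> x)) has_derivative
      (\<lambda>h. (2 / (1 - x \<bullet> x)) * (2 / (1 - x \<bullet> x)) * (x \<bullet> h))) (at x)"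
    by (auto intro!: derivative_eq_intros simp: inner_commute field_simps power2_eq_square)
  then show ?thesis unfolding hconf_def[abs_def] power2_norm_eq_inner .
qed

text \<open>The gradient of \<open>hconf\<close> is \<open>hconf\<close>^2 times x, again built from
  \<open>hconf\<close> and coordinates, so every order follows from the previous one by the product
  rule.\<close>

lemma diff_upto_hconf:
  assumes "open S" "S \<subseteq> ball 0 1"
  shows "diff_upto n S hconf"
proof (induction n)
  have d: "(hconf has_derivative (\<lambda>h. hconf x * hconf x * (x \<bullet> h))) (at x)" if "x \<in> S" for x
    using that assms(2) by (intro has_derivative_hconf) auto
  have *: "hconf differentiable_on S"
    by (rule differentiable_at_imp_differentiable_on) (use d differentiableI in blast)
  case 0
  show ?case using * by simp
  case (Suc n)
  have "diff_upto n S (\<lambda>x. frechet_derivative hconf (at x) i)" for i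
  proof (subst diff_upto_cong[OF assms(1)])
    show "frechet_derivative hconf (at x) i = hconf x * hconf x * (x \<bullet> i)" if "x \<in> S" for x
      by (simp add: frechet_derivative_at[OF d[OF that], symmetric])
    show "diff_upto n S (\<lambda>x. hconf x * hconf x * (x \<bullet> i))"
      using Suc by (intro diff_upto_mult[OF assms(1)] diff_upto_inner)
  qed
  then show ?case using * by simp
qed

lemma pderivs_append: "pderivs (is @ js) f = pderivs is (pderivs js f)"
  by (induction "is") auto

text \<open>The last entry of a \<open>pderivs\<close> list is differentiated first, so appending a
  direction at the end peels off the innermost derivative.\<close>

lemma smooth_on_imp_diff_upto:
  "smooth_on S f \<Longrightarrow> diff_upto n S f"
proof (induction n arbitrary: f)
  case 0
  then show ?case unfolding smooth_on_def
    by (metis diff_upto.simps(1) empty_subsetI list.set(1) pderivs.simps(1))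
next
  case (Suc n)
  have "smooth_on S (\<lambda>x. frechet_derivative f (at x) i)" if "i \<in> Basis" for i
    unfolding smooth_on_def
  proof (intro allI impI)
    fix js :: "'a list" assume "set js \<subseteq> Basis"
    then have "pderivs (js @ [i]) f differentiable_on S"
      using Suc.prems that unfolding smooth_on_def by (metis Un_subset_iff empty_set list.simps(15) insert_subset empty_subsetI set_append)
    then show "pderivs js (\<lambda>x. frechet_derivative f (at x) i) differentiable_on S"
      by (simp add: pderivs_append)
  qed
  moreover have "f differentiable_on S"
    using Suc.prems unfolding smooth_on_def by (metis empty_subsetI list.set(1) pderivs.simps(1))
  ultimately show ?case using Suc.IH by simp
qed

text \<open>Induction on the number of indices, for all lists and all orders at once: the partial
  derivative uses the hypothesis one order higher, and the Christoffel terms use it for other lists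
  of the same length.\<close>

lemma diff_upto_cov:
  assumes "open S" "S \<subseteq> ball 0 1" "smooth_on S u" "set is \<subseteq> Basis"
  shows "diff_upto n S (cov is u)"
  using assms(4)
proof (induction "length is" arbitrary: "is" n)
  case 0
  then show ?case using assms(3) smooth_on_imp_diff_upto by auto
next
  case (Suc d)
  obtain k js where is_eq: "is = k # js" using Suc.hyps(2) by (cases "is") auto
  have k: "k \<in> Basis" and js: "set js \<subseteq> Basis" and d: "d = length js"
    using Suc.prems Suc.hyps(2) by (auto simp: is_eq)
  have ih: "diff_upto n S (cov js' u)" if "set js' \<subseteq> Basis" "length js' = d" for js' n
    using Suc.hyps(1) that by auto
  have "diff_upto n S (\<lambda>x. frechet_derivative (cov js u) (at x) k)"
    using ih[OF js d[symmetric], of "Suc n"] k by simp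
  moreover have "diff_upto n S (cov (js[m := l]) u)" if "l \<in> Basis" "m < length js" for m l
    using that js d by (intro ih) (auto dest: set_update_subset_insert[THEN subsetD])
  moreover have "diff_upto n S (\<lambda>x. christoffel x l i j)" for l i j :: 'a
    unfolding christoffel_def
    by (intro diff_upto_mult diff_upto_add diff_upto_diff diff_upto_inner diff_upto_const diff_upto_hconf assms)
  ultimately show ?case unfolding is_eq cov.simps
    by (intro diff_upto_diff diff_upto_sum diff_upto_mult assms(1)) auto
qed

lemma cov_differentiable_on:
  assumes "open S" "S \<subseteq> ball 0 1" "smooth_on S u" "set is \<subseteq> Basis"
  shows "cov is u differentiable_on S"
  using diff_upto_cov[OF assms, of 0] by simp

text \<open>Normalising by \<open>sgn\<close> lets every nonzero vector label a ray. Directions can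
  then be drawn from a set of positive Lebesgue measure, and no surface measure on the sphere is
  needed.\<close>

definition ray :: "real \<Rightarrow> 'a::euclidean_space \<Rightarrow> 'a" where
  "ray t x = tanh (t / 2) *\<^sub>R sgn x"

lemma hdist_tanh:
  fixes \<theta> :: "'a::euclidean_space"
  assumes "norm \<theta> = 1" "t \<ge> 0"
  shows "hdist (tanh (t / 2) *\<^sub>R \<theta>) = t"
proof -
  have n: "norm (tanh (t / 2) *\<^sub>R \<theta>) = tanh (t / 2)" using assms by simp
  have p: "1 + exp (- t) > 0" by (simp add: add_pos_pos)
  have 1: "1 + tanh (t / 2) = 2 / (1 + exp (- t))"
    using p by (simp add: tanh_real_altdef field_simps)
  have 2: "1 - tanh (t / 2) = 2 * exp (- t) / (1 + exp (- t))"
    using p by (simp add: tanh_real_altdef field_simps)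
  have "(1 + tanh (t / 2)) / (1 - tanh (t / 2)) = exp t"
    unfolding 1 2 using p by (simp add: exp_minus field_simps)
  then show ?thesis unfolding hdist_def n by simp
qed

lemma norm_ray: "x \<noteq> 0 \<Longrightarrow> t \<ge> 0 \<Longrightarrow> norm (ray t x) = tanh (t / 2)"
  by (simp add: ray_def norm_sgn)

lemma hdist_ray: "x \<noteq> 0 \<Longrightarrow> t \<ge> 0 \<Longrightarrow> hdist (ray t x) = t"
  unfolding ray_def by (rule hdist_tanh) (auto simp: norm_sgn)

lemma ray_in_hball: "x \<noteq> 0 \<Longrightarrow> t \<in> ival R \<Longrightarrow> ray t x \<in> hball R - {0}"
  using norm_ray[of x t] hdist_ray[of x t] tanh_real_lt_1[of "t/2"]
  by (auto simp: hball_def ival_def)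

lemma sgn_ray: "t > 0 \<Longrightarrow> sgn (ray t x) = sgn x"
  using sgn_div_norm[of "sgn x"] by (cases "x = 0") (simp_all add: ray_def sgn_scaleR norm_sgn)

text \<open>The contraction of T with j copies of the g-unit radial vector. The coordinates of that
  vector are (1 - |x|^2)/2 times those of \<open>sgn x\<close>, which explains the power in front;
  it is the velocity of \<open>ray\<close>.\<close>

definition radial_part :: "nat \<Rightarrow> ('a::euclidean_space list \<Rightarrow> real) \<Rightarrow> 'a \<Rightarrow> real" where
  "radial_part j T x = ((1 - (norm x)^2) / 2) ^ j * (\<Sum>is\<in>idx j. T is * (\<Prod>m<j. sgn x \<bullet> is ! m))"

section \<open>Sums over multi-indices and the pointwise bound\<close>

lemma idx_0: "idx 0 = {[]}"
  by (auto simp: idx_def)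

lemma sum_idx_Suc:
  fixes F :: "'a::euclidean_space list \<Rightarrow> 'b::comm_monoid_add"
  shows "(\<Sum>is\<in>idx (Suc j). F is) = (\<Sum>k\<in>Basis. \<Sum>is\<in>idx j. F (k # is))"
proof -
  have "idx (Suc j) = (\<lambda>(k, is). k # is) ` (Basis \<times> (idx j :: 'a list set))"
    unfolding idx_def by (auto simp: image_iff length_Suc_conv)
  then have "(\<Sum>is\<in>idx (Suc j). F is) = (\<Sum>(k, is)\<in>Basis \<times> idx j. F (k # is))"
    by (simp add: sum.reindex inj_on_def case_prod_unfold)
  then show ?thesis by (simp add: sum.cartesian_product)
qed

text \<open>The squared norm of the j-fold tensor power of \<theta>; the sum factorises index by
  index.\<close>

lemma sum_idx_prod_squares:
  fixes \<theta> :: "'a::euclidean_space"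
  shows "(\<Sum>is\<in>idx j. (\<Prod>m<j. \<theta> \<bullet> is ! m)\<^sup>2) = (\<theta> \<bullet> \<theta>) ^ j"
proof (induction j)
  case 0
  then show ?case by (simp add: idx_0)
next
  case (Suc j)
  have "(\<Sum>is\<in>idx (Suc j). (\<Prod>m<Suc j. \<theta> \<bullet> is ! m)\<^sup>2)
    = (\<Sum>k\<in>Basis. \<Sum>is\<in>idx j. (\<theta> \<bullet> k)\<^sup>2 * (\<Prod>m<j. \<theta> \<bullet> is ! m)\<^sup>2)"
    unfolding sum_idx_Suc prod.lessThan_Suc_shift by (simp add: power_mult_distrib)
  also have "\<dots> = (\<Sum>k\<in>Basis. (\<theta> \<bullet> k)\<^sup>2) * (\<theta> \<bullet> \<theta>) ^ j"
    by (simp add: sum_distrib_left[symmetric] sum_distrib_right Suc)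
  also have "(\<Sum>k\<in>Basis. (\<theta> \<bullet> k)\<^sup>2) = \<theta> \<bullet> \<theta>"
    using euclidean_inner[of \<theta> \<theta>] by (simp add: power2_eq_square)
  finally show ?case by simp
qed

lemma abs_radial_part_le_tnorm:
  assumes "norm x < 1"
  shows "\<bar>radial_part j T x\<bar> \<le> tnorm j T x"
proof -
  let ?P = "\<lambda>is. \<Prod>m<j. sgn x \<bullet> is ! m"
  have "(\<Sum>is\<in>idx j. T is * ?P is)\<^sup>2 \<le> (\<Sum>is\<in>idx j. (T is)\<^sup>2) * (\<Sum>is\<in>idx j. (?P is)\<^sup>2)"
    by (rule Cauchy_Schwarz_ineq_sum)
  \<comment> \<open>Only an inequality, because \<open>sgn x\<close> is 0 rather than a unit vector
    at the origin.\<close>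
  also have "\<dots> \<le> (\<Sum>is\<in>idx j. (T is)\<^sup>2) * 1"
    unfolding sum_idx_prod_squares
    by (intro mult_left_mono sum_nonneg power_le_one)
       (auto simp: dot_square_norm norm_sgn)
  finally have "sqrt ((\<Sum>is\<in>idx j. T is * ?P is)\<^sup>2) \<le> sqrt ((\<Sum>is\<in>idx j. (T is)\<^sup>2) * 1)"
    by (rule real_sqrt_le_mono)
  then have "\<bar>\<Sum>is\<in>idx j. T is * ?P is\<bar> \<le> sqrt (\<Sum>is\<in>idx j. (T is)\<^sup>2)"
    unfolding real_sqrt_abs mult_1_right .
  moreover have "((1 - (norm x)^2) / 2) ^ j \<ge> 0"
    using assms by (intro zero_le_power) (auto simp: abs_square_le_1)
  ultimately show ?thesis
    unfolding radial_part_def tnorm_def by (simp add: abs_mult mult_left_mono)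
qed

lemma radial_part_diff: "radial_part j (\<lambda>is. S is - T is) x = radial_part j S x - radial_part j T x"
  unfolding radial_part_def by (simp add: left_diff_distrib sum_subtractf right_diff_distrib)

text \<open>With \<open>\<gamma>(t) = tanh (t/2) \<theta>\<close> this says that \<open>\<gamma>\<close> is a geodesic.\<close>

lemma christoffel_radial:
  fixes \<theta> :: "'a::euclidean_space"
  assumes "norm \<theta> = 1" "l \<in> Basis"
  shows "(\<Sum>i\<in>Basis. (\<theta> \<bullet> i) * (\<Sum>k\<in>Basis. (\<theta> \<bullet> k) * christoffel (r *\<^sub>R \<theta>) l k i))
    = hconf (r *\<^sub>R \<theta>) * r * (\<theta> \<bullet> l)"
proof -
  have sq: "(\<Sum>k\<in>Basis. (\<theta> \<bullet> k) * (\<theta> \<bullet> k)) = 1"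
    using assms(1) euclidean_inner[of \<theta> \<theta>] by (simp add: dot_square_norm)
  \<comment> \<open>Contracting one lower slot is enough: at a multiple of \<theta> the last two
    Christoffel terms cancel each other, and the first one leaves \<open>hconf * r\<close> times the
    identity because \<theta> is a unit vector.\<close>
  have "(\<theta> \<bullet> i) * (\<Sum>k\<in>Basis. (\<theta> \<bullet> k) * christoffel (r *\<^sub>R \<theta>) l k i)
     = hconf (r *\<^sub>R \<theta>) * r * (if i = l then \<theta> \<bullet> l else 0)" if i: "i \<in> Basis" for i
  proof -
    have "(\<Sum>k\<in>Basis. (\<theta> \<bullet> k) * christoffel (r *\<^sub>R \<theta>) l k i)
      = hconf (r *\<^sub>R \<theta>) * r * (\<Sum>k\<in>Basis. (if i = l then 1 else 0) * ((\<theta> \<bullet> k) * (\<theta> \<bullet> k))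
          + (if k = l then (\<theta> \<bullet> i) * (\<theta> \<bullet> l) else 0) - (if k = i then (\<theta> \<bullet> i) * (\<theta> \<bullet> l) else 0))"
      unfolding sum_distrib_left christoffel_def
      by (intro sum.cong refl) (auto simp: algebra_simps)
    also have "\<dots> = hconf (r *\<^sub>R \<theta>) * r * (if i = l then 1 else 0)"
      using i assms(2) sq
      by (simp add: sum.distrib sum_subtractf sum_distrib_left[symmetric])
    finally show ?thesis by auto
  qed
  then have "(\<Sum>i\<in>Basis. (\<theta> \<bullet> i) * (\<Sum>k\<in>Basis. (\<theta> \<bullet> k) * christoffel (r *\<^sub>R \<theta>) l k i))
    = (\<Sum>i\<in>Basis. hconf (r *\<^sub>R \<theta>) * r * (if i = l then \<theta> \<bullet> l else 0))"
    by (intro sum.cong) auto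
  also have "\<dots> = hconf (r *\<^sub>R \<theta>) * r * (\<theta> \<bullet> l)"
    using assms(2) by (simp add: sum_distrib_left[symmetric])
  finally show ?thesis .
qed

text \<open>The involution \<open>(is, l) \<mapsto> (is[m := l], is ! m)\<close> moves the update from \<open>T\<close> to the product.\<close>

lemma christoffel_contraction:
  fixes \<theta> :: "'a::euclidean_space" and T :: "'a list \<Rightarrow> real"
  assumes "norm \<theta> = 1" "m < j"
  shows "(\<Sum>is\<in>idx j. \<Sum>l\<in>Basis. (\<Prod>n<j. \<theta> \<bullet> is ! n) *
      (\<Sum>k\<in>Basis. (\<theta> \<bullet> k) * christoffel (r *\<^sub>R \<theta>) l k (is ! m)) * T (is[m := l]))
    = hconf (r *\<^sub>R \<theta>) * r * (\<Sum>is\<in>idx j. T is * (\<Prod>n<j. \<theta> \<bullet> is ! n))"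
proof -
  let ?P = "\<lambda>is. \<Prod>n<j. \<theta> \<bullet> is ! n"
  let ?Q = "\<lambda>is. \<Prod>n\<in>{..<j} - {m}. \<theta> \<bullet> is ! n"
  let ?C = "\<lambda>l i. \<Sum>k\<in>Basis. (\<theta> \<bullet> k) * christoffel (r *\<^sub>R \<theta>) l k i"
  have P: "?P is = (\<theta> \<bullet> is ! m) * ?Q is" for "is"
    using assms(2) by (subst prod.remove[of _ m]) auto
  have Qupd: "?Q (is[m := l]) = ?Q is" for "is" l
    by (intro prod.cong) auto
  have "(\<Sum>is\<in>idx j. \<Sum>l\<in>Basis. ?P is * ?C l (is ! m) * T (is[m := l]))
    = (\<Sum>(is, l)\<in>idx j \<times> Basis. ?P is * ?C l (is ! m) * T (is[m := l]))"
    by (simp add: sum.cartesian_product)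
  also have "\<dots> = (\<Sum>(is, l)\<in>idx j \<times> Basis. ?P (is[m := l]) * ?C (is ! m) l * T is)"
  proof (rule sum.reindex_bij_witness[of _ "\<lambda>(is, l). (is[m := l], is ! m)" "\<lambda>(is, l). (is[m := l], is ! m)"])
    fix q :: "'a list \<times> 'a" assume "q \<in> idx j \<times> Basis"
    then obtain "is" l where q: "q = (is, l)" "set is \<subseteq> Basis" "length is = j" "l \<in> Basis"
      by (auto simp: idx_def)
    have "set (is[m := l]) \<subseteq> Basis" using q by (meson insert_subsetI order_trans set_update_subset_insert)
    moreover have "is ! m \<in> Basis" using q assms(2) by (meson nth_mem subsetD)
    ultimately show "(case q of (is, l) \<Rightarrow> (is[m := l], is ! m)) \<in> idx j \<times> Basis"
      "(case q of (is, l) \<Rightarrow> (is[m := l], is ! m)) \<in> idx j \<times> Basis"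
      using q by (auto simp: idx_def)
  qed (use assms(2) in \<open>auto simp: idx_def\<close>)
  also have "\<dots> = (\<Sum>is\<in>idx j. \<Sum>l\<in>Basis. ?P (is[m := l]) * ?C (is ! m) l * T is)"
    by (simp add: sum.cartesian_product)
  also have "\<dots> = (\<Sum>is\<in>idx j. hconf (r *\<^sub>R \<theta>) * r * (T is * ?P is))"
  proof (rule sum.cong[OF refl])
    fix "is" :: "'a list" assume i: "is \<in> idx j"
    have m: "is ! m \<in> Basis" and len: "length is = j"
      using i assms(2) unfolding idx_def by auto
    \<comment> \<open>After the swap \<open>T\<close> is free of \<open>l\<close>, and of the
      product only the \<open>m\<close>-th factor depends on it, so the sum over \<open>l\<close> is
      the one in \<open>christoffel_radial\<close>.\<close>
    have "(\<Sum>l\<in>Basis. ?P (is[m := l]) * ?C (is ! m) l * T is)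
      = (\<Sum>l\<in>Basis. T is * ?Q is * ((\<theta> \<bullet> l) * ?C (is ! m) l))"
      using assms(2) len by (intro sum.cong refl) (simp add: P Qupd algebra_simps)
    also have "\<dots> = T is * ?Q is * (hconf (r *\<^sub>R \<theta>) * r * (\<theta> \<bullet> is ! m))"
      by (simp only: sum_distrib_left[symmetric] christoffel_radial[OF assms(1) m])
    finally show "(\<Sum>l\<in>Basis. ?P (is[m := l]) * ?C (is ! m) l * T is) = hconf (r *\<^sub>R \<theta>) * r * (T is * ?P is)"
      by (simp add: P algebra_simps)
  qed
  finally show ?thesis by (simp add: sum_distrib_left)
qed

text \<open>The partial derivatives combine to the derivative along \<theta>, and each of the j
  tensor slots contributes the same correction by \<open>christoffel_contraction\<close>.\<close>

lemma sum_idx_cov_Suc: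
  fixes \<theta> :: "'a::euclidean_space"
  assumes "norm \<theta> = 1"
  shows "(\<Sum>is\<in>idx (Suc j). cov is u (r *\<^sub>R \<theta>) * (\<Prod>m<Suc j. \<theta> \<bullet> is ! m))
    = (\<Sum>is\<in>idx j. (\<Sum>k\<in>Basis. (\<theta> \<bullet> k) * frechet_derivative (cov is u) (at (r *\<^sub>R \<theta>)) k) * (\<Prod>m<j. \<theta> \<bullet> is ! m))
      - real j * hconf (r *\<^sub>R \<theta>) * r * (\<Sum>is\<in>idx j. cov is u (r *\<^sub>R \<theta>) * (\<Prod>m<j. \<theta> \<bullet> is ! m))"
proof -
  let ?P = "\<lambda>is. \<Prod>m<j. \<theta> \<bullet> is ! m"
  let ?x = "r *\<^sub>R \<theta>"
  let ?D = "\<lambda>is k. frechet_derivative (cov is u) (at ?x) k"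
  have "(\<Sum>is\<in>idx (Suc j). cov is u ?x * (\<Prod>m<Suc j. \<theta> \<bullet> is ! m))
    = (\<Sum>k\<in>Basis. \<Sum>is\<in>idx j. (\<theta> \<bullet> k) * ?D is k * ?P is
         - (\<Sum>m<j. \<Sum>l\<in>Basis. ?P is * ((\<theta> \<bullet> k) * christoffel ?x l k (is ! m)) * cov (is[m := l]) u ?x))"
    unfolding sum_idx_Suc prod.lessThan_Suc_shift
    by (intro sum.cong refl) (auto simp: idx_def algebra_simps sum_distrib_left sum_distrib_right)
  also have "\<dots> = (\<Sum>is\<in>idx j. \<Sum>k\<in>Basis. (\<theta> \<bullet> k) * ?D is k * ?P is)
     - (\<Sum>k\<in>Basis. \<Sum>is\<in>idx j. \<Sum>m<j. \<Sum>l\<in>Basis. ?P is * ((\<theta> \<bullet> k) * christoffel ?x l k (is ! m)) * cov (is[m := l]) u ?x)"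
    unfolding sum_subtractf
    by (rule arg_cong2[of _ _ _ _ "(-)", OF sum.swap refl])
  \<comment> \<open>The sums are permuted until the one over \<open>k\<close> is innermost, where it
    meets only the Christoffel symbol.\<close>
  also have "(\<Sum>k\<in>Basis. \<Sum>is\<in>idx j. \<Sum>m<j. \<Sum>l\<in>Basis. ?P is * ((\<theta> \<bullet> k) * christoffel ?x l k (is ! m)) * cov (is[m := l]) u ?x)
    = (\<Sum>m<j. \<Sum>is\<in>idx j. \<Sum>l\<in>Basis. \<Sum>k\<in>Basis. ?P is * ((\<theta> \<bullet> k) * christoffel ?x l k (is ! m)) * cov (is[m := l]) u ?x)"
    (is "?L = ?R")
  proof -
    have "?L = (\<Sum>is\<in>idx j. \<Sum>k\<in>Basis. \<Sum>m<j. \<Sum>l\<in>Basis. ?P is * ((\<theta> \<bullet> k) * christoffel ?x l k (is ! m)) * cov (is[m := l]) u ?x)"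
      by (rule sum.swap)
    also have "\<dots> = (\<Sum>is\<in>idx j. \<Sum>m<j. \<Sum>k\<in>Basis. \<Sum>l\<in>Basis. ?P is * ((\<theta> \<bullet> k) * christoffel ?x l k (is ! m)) * cov (is[m := l]) u ?x)"
      by (intro sum.cong refl sum.swap)
    also have "\<dots> = (\<Sum>is\<in>idx j. \<Sum>m<j. \<Sum>l\<in>Basis. \<Sum>k\<in>Basis. ?P is * ((\<theta> \<bullet> k) * christoffel ?x l k (is ! m)) * cov (is[m := l]) u ?x)"
      by (intro sum.cong refl sum.swap)
    also have "\<dots> = ?R" by (rule sum.swap)
    finally show ?thesis .
  qed
  also have "\<dots> = (\<Sum>m<j. \<Sum>is\<in>idx j. \<Sum>l\<in>Basis. ?P is * (\<Sum>k\<in>Basis. (\<theta> \<bullet> k) * christoffel ?x l k (is ! m)) * cov (is[m := l]) u ?x)"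
    by (simp only: sum_distrib_left sum_distrib_right)
  also have "\<dots> = (\<Sum>m<j. hconf ?x * r * (\<Sum>is\<in>idx j. cov is u ?x * ?P is))"
    by (intro sum.cong refl christoffel_contraction assms) auto
  finally show ?thesis by (simp add: sum_distrib_right)
qed

text \<open>With q = r' the radial part is q^j times the contraction with \<theta>. As q' = - r q,
  differentiating q^j produces - j r q^j. This is exactly the Christoffel correction of the next
  contraction multiplied by q^(j+1), because \<open>hconf\<close> and q are reciprocal along the
  ray.\<close>

lemma radial_part_cov_has_derivative:
  fixes x :: "'a::euclidean_space"
  assumes S: "open S" "S \<subseteq> ball 0 1" "smooth_on S u" and x: "x \<noteq> 0" and t: "t > 0" "ray t x \<in> S"
  shows "((\<lambda>t. radial_part j (\<lambda>is. cov is u (ray t x)) (ray t x)) has_real_derivative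
    radial_part (Suc j) (\<lambda>is. cov is u (ray t x)) (ray t x)) (at t)"
proof -
  define \<theta> where "\<theta> = sgn x"
  have \<theta>: "norm \<theta> = 1" using x by (simp add: \<theta>_def norm_sgn)
  define r where "r t = tanh (t / 2)" for t :: real
  define q where "q t = (1 - (r t)\<^sup>2) / 2" for t
  define E where "E j t = (\<Sum>is\<in>idx j. cov is u (r t *\<^sub>R \<theta>) * (\<Prod>m<j. \<theta> \<bullet> is ! m))" for j t
  have rp: "radial_part j (\<lambda>is. cov is u (ray s x)) (ray s x) = q s ^ j * E j s" if "s > 0" for s j
    unfolding radial_part_def sgn_ray[OF that] using that x
    by (simp add: norm_ray q_def E_def r_def ray_def \<theta>_def norm_sgn)
  have rt: "r t *\<^sub>R \<theta> = ray t x" by (simp add: r_def ray_def \<theta>_def)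
  have dr: "(r has_real_derivative q t) (at t)"
    unfolding r_def q_def
    by (auto intro!: derivative_eq_intros simp: cosh_real_nonzero)
  have dq: "(q has_real_derivative - (r t * q t)) (at t)"
    unfolding q_def[abs_def] by (auto intro!: derivative_eq_intros dr simp: q_def)
  have dcov: "((\<lambda>t. cov is u (r t *\<^sub>R \<theta>)) has_real_derivative
      q t * (\<Sum>k\<in>Basis. (\<theta> \<bullet> k) * frechet_derivative (cov is u) (at (r t *\<^sub>R \<theta>)) k)) (at t)"
    if "set is \<subseteq> Basis" for "is"
  proof -
    let ?D = "frechet_derivative (cov is u) (at (r t *\<^sub>R \<theta>))"
    have D: "(cov is u has_derivative ?D) (at (r t *\<^sub>R \<theta>))"
      using cov_differentiable_on[OF S that] t(2) S(1) rt
      by (metis differentiable_onD_open frechet_derivative_works)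
    interpret D: bounded_linear ?D by (rule has_derivative_bounded_linear[OF D])
    have "((\<lambda>t. r t *\<^sub>R \<theta>) has_derivative (\<lambda>h. (h * q t) *\<^sub>R \<theta>)) (at t)"
      using dr unfolding has_field_derivative_def
      by (auto intro!: derivative_eq_intros simp: mult.commute)
    from has_derivative_compose[OF this D]
    have "((\<lambda>t. cov is u (r t *\<^sub>R \<theta>)) has_derivative (\<lambda>h. ?D ((h * q t) *\<^sub>R \<theta>))) (at t)" .
    moreover have "?D \<theta> = (\<Sum>k\<in>Basis. (\<theta> \<bullet> k) * ?D k)"
    proof -
      have "?D \<theta> = ?D (\<Sum>k\<in>Basis. (\<theta> \<bullet> k) *\<^sub>R k)" by (simp add: euclidean_representation)
      also have "\<dots> = (\<Sum>k\<in>Basis. (\<theta> \<bullet> k) * ?D k)" unfolding D.sum D.scaleR by simp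
      finally show ?thesis .
    qed
    moreover have "?D ((h * q t) *\<^sub>R \<theta>) = q t * ?D \<theta> * h" for h
      unfolding D.scaleR by simp
    ultimately show ?thesis unfolding has_field_derivative_def by simp
  qed
  have dE: "(E j has_real_derivative q t * (\<Sum>is\<in>idx j. (\<Sum>k\<in>Basis. (\<theta> \<bullet> k) *
      frechet_derivative (cov is u) (at (r t *\<^sub>R \<theta>)) k) * (\<Prod>m<j. \<theta> \<bullet> is ! m))) (at t)"
  proof -
    have "(E j has_real_derivative (\<Sum>is\<in>idx j. (q t * (\<Sum>k\<in>Basis. (\<theta> \<bullet> k) *
      frechet_derivative (cov is u) (at (r t *\<^sub>R \<theta>)) k)) * (\<Prod>m<j. \<theta> \<bullet> is ! m))) (at t)"
      unfolding E_def[abs_def]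
      by (intro DERIV_sum DERIV_cmult_right dcov) (auto simp: idx_def)
    then show ?thesis by (simp only: mult.assoc sum_distrib_left[symmetric])
  qed
  have lam: "hconf (r t *\<^sub>R \<theta>) * q t = 1"
  proof -
    have "\<bar>r t\<bar> < 1" unfolding r_def using tanh_real_bounds[of "t/2"] by auto
    then have "(r t)\<^sup>2 < 1" by (simp add: abs_square_less_1)
    then show ?thesis unfolding hconf_def q_def using \<theta> by simp
  qed
  have ES: "E (Suc j) t = (\<Sum>is\<in>idx j. (\<Sum>k\<in>Basis. (\<theta> \<bullet> k) *
      frechet_derivative (cov is u) (at (r t *\<^sub>R \<theta>)) k) * (\<Prod>m<j. \<theta> \<bullet> is ! m))
      - real j * hconf (r t *\<^sub>R \<theta>) * r t * E j t" (is "_ = ?Z - _")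
    unfolding E_def by (rule sum_idx_cov_Suc[OF \<theta>])
  have "((\<lambda>s. q s ^ j * E j s) has_real_derivative
     (real j * q t ^ (j - 1) * (- (r t * q t))) * E j t + q t ^ j * (q t * ?Z)) (at t)"
    by (auto intro!: derivative_eq_intros dq dE simp: algebra_simps)
  also have "(real j * q t ^ (j - 1) * (- (r t * q t))) * E j t + q t ^ j * (q t * ?Z)
     = q t ^ Suc j * E (Suc j) t"
  proof -
    have "q t ^ Suc j * (real j * hconf (r t *\<^sub>R \<theta>) * r t * E j t)
      = (hconf (r t *\<^sub>R \<theta>) * q t) * (q t ^ j * real j * r t * E j t)" by simp
    also have "\<dots> = q t ^ j * real j * r t * E j t" unfolding lam by simp
    \<comment> \<open>For \<open>j = 0\<close> the exponent is truncated, but then the factor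
      \<open>real j\<close> vanishes.\<close>
    also have "\<dots> = real j * q t ^ (j - 1) * (r t * q t) * E j t" by (cases j) auto
    finally have c: "q t ^ Suc j * (real j * hconf (r t *\<^sub>R \<theta>) * r t * E j t)
      = real j * q t ^ (j - 1) * (r t * q t) * E j t" .
    show ?thesis unfolding ES right_diff_distrib c by simp
  qed
  finally have "((\<lambda>s. q s ^ j * E j s) has_real_derivative q t ^ Suc j * E (Suc j) t) (at t)" .
  then show ?thesis unfolding rp[OF t(1)]
    by (rule has_field_derivative_transform_within_open[where S="{0<..}"]) (use t rp in auto)
qed

section \<open>Openness of geodesic balls\<close>

lemma continuous_on_hdist: "continuous_on {x::'a::euclidean_space. norm x < 1} hdist"
  unfolding hdist_def
  by (auto intro!: continuous_intros simp: divide_pos_pos add_pos_nonneg) (smt (verit) norm_ge_zero)+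

lemma open_hball: "open (hball R :: 'a::euclidean_space set)"
proof -
  have "open {x::'a. norm x < 1}"
    using open_ball[of "0::'a" 1] by (simp add: ball_def dist_norm)
  moreover have "open (ereal -` {..<R})" by (rule open_ereal_vimage) auto
  ultimately have "open ({x::'a. norm x < 1} \<inter> hdist -` (ereal -` {..<R}))"
    by (intro continuous_open_preimage continuous_on_hdist)
  also have "\<dots> = hball R" by (auto simp: hball_def)
  finally show ?thesis .
qed

lemma hball_subset_ball: "hball R \<subseteq> ball 0 1"
  by (auto simp: hball_def)

section \<open>Integration over rays\<close>

lemma ex_tanh_ge:
  assumes "r < (1::real)"
  shows "\<exists>n::nat. r \<le> tanh (real (Suc n) / 2)"
proof -
  have "((\<lambda>x. tanh x :: real) \<longlongrightarrow> 1) at_top" by (rule tanh_real_at_top)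
  then have "\<forall>\<^sub>F x in at_top. tanh x > r" using assms by (rule order_tendstoD)
  then obtain X where X: "\<And>x. x \<ge> X \<Longrightarrow> tanh x > r" by (auto simp: eventually_at_top_linorder)
  obtain n :: nat where "2 * X \<le> real n" using real_arch_simple by blast
  then have "X \<le> real (Suc n) / 2" by simp
  then show ?thesis using X less_imp_le by blast
qed

text \<open>The substitution rule is applied on compact intervals. Exhausting the half line by
  \<open>{0..real (Suc n)}\<close> and using continuity from below of the two density measures
  removes the restriction; \<open>Suc n\<close> keeps every interval nondegenerate.\<close>

lemma nn_integral_tanh_substitution:
  fixes f :: "real \<Rightarrow> ennreal"
  assumes [measurable]: "f \<in> borel_measurable borel"
  shows "(\<integral>\<^sup>+r. f r * indicator {0<..<1} r \<partial>lborel)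
    = (\<integral>\<^sup>+t. f (tanh (t / 2)) * ennreal ((1 - (tanh (t / 2))\<^sup>2) / 2) * indicator {0<..} t \<partial>lborel)"
proof -
  define g where "g t = f (tanh (t / 2)) * ennreal ((1 - (tanh (t / 2))\<^sup>2) / 2)" for t
  have [measurable]: "(\<lambda>t::real. tanh (t / 2)) \<in> borel_measurable borel"
    by (intro borel_measurable_continuous_onI continuous_intros) (simp_all add: less_imp_neq[OF cosh_real_pos, symmetric])
  have g[measurable]: "g \<in> borel_measurable borel" unfolding g_def by measurable
  have eqn: "emeasure (density lborel f) {0..tanh (real (Suc n) / 2)} = emeasure (density lborel g) {0..real (Suc n)}" for n
  proof -
    have "(\<integral>\<^sup>+r. f r * indicator {tanh (0 / 2)..tanh (real (Suc n) / 2)} r \<partial>lborel)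
      = (\<integral>\<^sup>+t. f (tanh (t / 2)) * ennreal ((1 - (tanh (t / 2))\<^sup>2) / 2) * indicator {0..real (Suc n)} t \<partial>lborel)"
    proof (rule nn_integral_substitution_aux[where g="\<lambda>t. tanh (t / 2)"])
      show "((\<lambda>t. tanh (t / 2)) has_real_derivative (1 - (tanh (x / 2))\<^sup>2) / 2) (at x)" for x :: real
        by (auto intro!: derivative_eq_intros simp: less_imp_neq[OF cosh_real_pos, symmetric])
      show "continuous_on {0..real (Suc n)} (\<lambda>x. (1 - (tanh (x / 2))\<^sup>2) / 2)"
        by (intro continuous_intros) (simp_all add: less_imp_neq[OF cosh_real_pos, symmetric])
      show "0 \<le> (1 - (tanh (x / 2))\<^sup>2) / 2" for x :: real
      proof -
        have "\<bar>tanh (x / 2)\<bar> \<le> 1" using tanh_real_bounds[of "x/2"] by auto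
        then have "(tanh (x / 2))\<^sup>2 \<le> 1" by (simp add: abs_square_le_1)
        then show ?thesis by simp
      qed
    qed auto
    then show ?thesis by (simp add: emeasure_density g_def)
  qed
  have 1: "(SUP n. emeasure (density lborel f) {0..tanh (real (Suc n) / 2)})
      = emeasure (density lborel f) (\<Union>n. {0..tanh (real (Suc n) / 2)})"
    by (rule SUP_emeasure_incseq) (auto simp: incseq_def intro: order_trans)
  have 2: "(SUP n. emeasure (density lborel g) {0..real (Suc n)})
      = emeasure (density lborel g) (\<Union>n. {0..real (Suc n)})"
    by (rule SUP_emeasure_incseq) (auto simp: incseq_def)
  have U1: "(\<Union>n. {0..tanh (real (Suc n) / 2)}) = {0..<1}"
  proof (intro subset_antisym subsetI)
    fix r :: real assume "r \<in> {0..<1}"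
    then show "r \<in> (\<Union>n. {0..tanh (real (Suc n) / 2)})" using ex_tanh_ge[of r] by simp
  next
    fix r :: real assume "r \<in> (\<Union>n. {0..tanh (real (Suc n) / 2)})"
    then obtain n where "0 \<le> r" "r \<le> tanh (real (Suc n) / 2)" by auto
    then show "r \<in> {0..<1}" using tanh_real_lt_1[of "real (Suc n) / 2"] by simp
  qed
  have U2: "(\<Union>n. {0..real (Suc n)}) = {0..}"
  proof -
    have "\<exists>n. x \<le> real (Suc n)" for x :: real
      by (metis real_arch_simple less_imp_le lessI of_nat_le_iff order_trans)
    then show ?thesis by auto
  qed
  have "(\<integral>\<^sup>+r. f r * indicator {0<..<1} r \<partial>lborel) = (\<integral>\<^sup>+r. f r * indicator {0..<1} r \<partial>lborel)"
    using AE_lborel_singleton[of "0::real"] by (intro nn_integral_cong_AE) (auto simp: indicator_def)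
  also have "\<dots> = emeasure (density lborel f) {0..<1}" by (simp add: emeasure_density)
  also have "\<dots> = emeasure (density lborel g) {0..}"
    using 1 2 unfolding U1 U2 eqn by simp
  also have "\<dots> = (\<integral>\<^sup>+t. g t * indicator {0..} t \<partial>lborel)" by (simp add: emeasure_density)
  also have "\<dots> = (\<integral>\<^sup>+t. g t * indicator {0<..} t \<partial>lborel)"
    using AE_lborel_singleton[of "0::real"] by (intro nn_integral_cong_AE) (auto simp: indicator_def)
  finally show ?thesis unfolding g_def .
qed

text \<open>The right side is the Euclidean radius times the conformal factor, that is, the scale of
  the geodesic sphere at distance t. It turns the volume density into the weight
  \<open>sinh t ^ (N - 1)\<close>.\<close>

lemma sinh_eq_tanh_half:
  fixes t :: real
  shows "sinh t = 2 * tanh (t / 2) / (1 - (tanh (t / 2))\<^sup>2)"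
proof -
  have c: "cosh (t / 2) \<noteq> 0" using cosh_real_pos[of "t / 2"] by linarith
  have "1 - (tanh (t / 2))\<^sup>2 = ((cosh (t / 2))\<^sup>2 - (sinh (t / 2))\<^sup>2) / (cosh (t / 2))\<^sup>2"
    using c by (simp add: tanh_def diff_divide_distrib power_divide)
  also have "\<dots> = 1 / (cosh (t / 2))\<^sup>2" using cosh_square_eq[of "t/2"] by simp
  finally have "1 - (tanh (t / 2))\<^sup>2 = 1 / (cosh (t / 2))\<^sup>2" .
  moreover have "sinh t = 2 * sinh (t / 2) * cosh (t / 2)"
    using sinh_double[of "t/2"] by simp
  ultimately show ?thesis using c by (simp add: tanh_def power2_eq_square)
qed

text \<open>The labels of the rays: a set of positive measure that contains every direction and
  stays away from the origin.\<close>

definition annulus :: "'a::euclidean_space set" where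
  "annulus = {x. 1 \<le> norm x \<and> norm x \<le> 2}"

lemma annulus_borel[measurable]: "annulus \<in> sets borel"
  unfolding annulus_def by measurable

text \<open>Needed to extract an actual good ray from a statement about almost every label.\<close>

lemma annulus_not_null: "emeasure lborel (annulus :: 'a::euclidean_space set) \<noteq> 0"
proof
  assume "emeasure lborel (annulus :: 'a set) = 0"
  then have n: "(annulus :: 'a set) \<in> null_sets lborel" by (simp add: null_setsI)
  have "open {x::'a. 1 < norm x \<and> norm x < 2}"
    by (intro open_Collect_conj open_Collect_less continuous_intros)
  moreover obtain b :: 'a where "b \<in> Basis" using nonempty_Basis by blast
  then have "(3/2) *\<^sub>R b \<in> {x::'a. 1 < norm x \<and> norm x < 2}" by simp
  ultimately have "\<not> negligible {x::'a. 1 < norm x \<and> norm x < 2}"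
    using open_not_negligible by blast
  moreover have "negligible (annulus :: 'a set)"
    using n by (simp add: negligible_iff_null_sets null_sets_completionI)
  then have "negligible {x::'a. 1 < norm x \<and> norm x < 2}"
    by (rule negligible_subset) (auto simp: annulus_def)
  ultimately show False by blast
qed

lemma ray_measurable[measurable (raw)]:
  assumes [measurable]: "f \<in> borel_measurable M" "g \<in> borel_measurable M"
  shows "(\<lambda>z. ray (f z) (g z :: 'a::euclidean_space)) \<in> borel_measurable M"
proof -
  have [measurable]: "(\<lambda>t::real. tanh (t / 2)) \<in> borel_measurable borel"
    by (intro borel_measurable_continuous_onI continuous_intros) (simp_all add: less_imp_neq[OF cosh_real_pos, symmetric])
  have "(\<lambda>z. tanh (f z / 2)) \<in> borel_measurable M" by measurable
  then show ?thesis unfolding ray_def sgn_div_norm by measurable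
qed

lemma hdens_measurable[measurable]: "hdens \<in> borel_measurable borel"
  unfolding hdens_def[abs_def] hconf_def[abs_def] by measurable

text \<open>The total weight with which a point y is counted when the dilates of the annulus sweep
  over it, with s the dilation factor divided by |y|. That it is finite carries integrability from
  the ball to rays; that it is nonzero carries null sets from rays back to the ball.\<close>

definition ray_const :: "nat \<Rightarrow> ennreal" where
  "ray_const N = (\<integral>\<^sup>+s. ennreal (1 / s ^ Suc N) * indicator {1/2..1} s \<partial>lborel)"

lemma ray_const_pos: "ray_const N \<noteq> 0"
proof -
  have "0 < ennreal (1 / 2)" by (simp del: ennreal_half)
  also have "ennreal (1 / 2) = (\<integral>\<^sup>+s. 1 * indicator {1/2..1::real} s \<partial>lborel)"
    using emeasure_lborel_Icc[of "1/2" 1] by (simp del: ennreal_half)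
  also have "\<dots> \<le> ray_const N" unfolding ray_const_def
  proof (intro nn_integral_mono)
    fix s :: real
    show "1 * indicator {1/2..1} s \<le> ennreal (1 / s ^ Suc N) * indicator {1/2..1} s"
    proof (cases "s \<in> {1/2..1}")
      case True
      then have "0 < s" "s \<le> 1" by auto
      then have "1 \<le> 1 / s ^ Suc N" using power_le_one[of s "Suc N"] by (simp add: field_simps)
      then have "ennreal 1 \<le> ennreal (1 / s ^ Suc N)" by (rule ennreal_leI)
      then show ?thesis using True by simp
    qed simp
  qed
  finally show ?thesis by simp
qed

lemma ray_const_finite: "ray_const N \<noteq> \<infinity>"
proof -
  have "ray_const N \<le> (\<integral>\<^sup>+s. ennreal (2 ^ Suc N) * indicator {1/2..1::real} s \<partial>lborel)"
    unfolding ray_const_def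
  proof (intro nn_integral_mono)
    fix s :: real
    show "ennreal (1 / s ^ Suc N) * indicator {1/2..1} s \<le> ennreal (2 ^ Suc N) * indicator {1/2..1} s"
    proof (cases "s \<in> {1/2..1}")
      case True
      then have "(1 / s) ^ Suc N \<le> 2 ^ Suc N" by (intro power_mono) (auto simp: field_simps)
      then show ?thesis using True by (auto simp: power_one_over intro!: ennreal_leI)
    qed simp
  qed
  also have "\<dots> = ennreal (2 ^ Suc N) * ennreal (1 / 2)"
    using emeasure_lborel_Icc[of "1/2" 1] by (simp add: nn_integral_cmult_indicator del: ennreal_half)
  also have "\<dots> < \<infinity>" unfolding infinity_ennreal_def by (intro ennreal_mult_less_top[THEN iffD2]) (simp del: ennreal_half)
  finally show ?thesis by simp
qed

lemma nn_integral_scaleR: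
  fixes f :: "'a::euclidean_space \<Rightarrow> ennreal"
  assumes [measurable]: "f \<in> borel_measurable borel" and c: "c > 0"
  shows "(\<integral>\<^sup>+y. f y \<partial>lborel) = (\<integral>\<^sup>+x. ennreal (c ^ DIM('a)) * f (c *\<^sub>R x) \<partial>lborel)"
  using c by (subst lborel_affine[of c 0]) (simp_all add: nn_integral_density nn_integral_distr)

text \<open>Scale invariance: under \<rho> = |y| s the norm of y cancels, and membership in the
  annulus becomes 1 \<le> 1/s \<le> 2, that is, s in [1/2, 1].\<close>

lemma nn_integral_annulus_dilations:
  fixes y :: "'a::euclidean_space"
  assumes "y \<noteq> 0"
  shows "(\<integral>\<^sup>+\<rho>. ennreal ((1 / \<rho>) * (norm y / \<rho>) ^ N) * indicator annulus ((1 / \<rho>) *\<^sub>R y) * indicator {0<..} \<rho> \<partial>lborel)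
    = ray_const N"
proof -
  define c where "c = norm y"
  have c: "c > 0" using assms by (simp add: c_def)
  have ind: "indicator annulus ((1 / \<rho>) *\<^sub>R y) = (indicator {1..2} (c / \<rho>) :: ennreal)" if "\<rho> > 0" for \<rho>
    using that by (simp add: annulus_def c_def indicator_def)
  have "(\<integral>\<^sup>+\<rho>. ennreal ((1 / \<rho>) * (norm y / \<rho>) ^ N) * indicator annulus ((1 / \<rho>) *\<^sub>R y) * indicator {0<..} \<rho> \<partial>lborel)
    = (\<integral>\<^sup>+\<rho>. ennreal ((1 / \<rho>) * (c / \<rho>) ^ N) * indicator {1..2} (c / \<rho>) * indicator {0<..} \<rho> \<partial>lborel)"
    by (intro nn_integral_cong) (auto simp: ind c_def[symmetric] split: split_indicator)
  also have "\<dots> = ennreal \<bar>c\<bar> * (\<integral>\<^sup>+s. ennreal ((1 / (0 + c * s)) * (c / (0 + c * s)) ^ N) *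
       indicator {1..2} (c / (0 + c * s)) * indicator {0<..} (0 + c * s) \<partial>lborel)"
    using c by (intro nn_integral_real_affine) auto
  also have "\<dots> = (\<integral>\<^sup>+s. ennreal c * (ennreal ((1 / (c * s)) * (c / (c * s)) ^ N) *
       indicator {1..2} (c / (c * s)) * indicator {0<..} (c * s)) \<partial>lborel)"
    using c by (subst nn_integral_cmult) auto
  also have "\<dots> = ray_const N"
    unfolding ray_const_def
  proof (intro nn_integral_cong)
    fix s :: real
    show "ennreal c * (ennreal ((1 / (c * s)) * (c / (c * s)) ^ N) * indicator {1..2} (c / (c * s)) * indicator {0<..} (c * s))
      = ennreal (1 / s ^ Suc N) * indicator {1/2..1} s"
    proof (cases "s > 0")
      case True
      have "ennreal c * ennreal ((1 / (c * s)) * (c / (c * s)) ^ N) = ennreal (1 / s ^ Suc N)"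
        using True c by (subst ennreal_mult[symmetric]) (auto simp: power_one_over field_simps)
      moreover have "indicator {1..2} (c / (c * s)) = (indicator {1/2..1} s :: ennreal)"
        using True c by (auto simp: indicator_def field_simps)
      moreover have "indicator {0<..} (c * s) = (1 :: ennreal)" using True c by simp
      ultimately show ?thesis by (simp add: mult.assoc[symmetric])
    next
      case False
      then show ?thesis using c by (auto simp: indicator_def zero_less_mult_iff)
    qed
  qed
  finally show ?thesis .
qed

text \<open>Two substitutions, r = tanh (t/2) and r = |x| \<rho>. They express the ray integral
  through the half line of multiples of x, where \<rho> no longer depends on x and can be exchanged
  with it.\<close>

lemma nn_integral_single_ray:
  fixes f :: "'a::euclidean_space \<Rightarrow> ennreal" and x :: 'a
  assumes [measurable]: "f \<in> borel_measurable borel" and x: "x \<noteq> 0"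
  defines "F \<equiv> \<lambda>y. f y * ennreal (hdens y) * indicator (ball 0 1) y"
  shows "(\<integral>\<^sup>+t. f (ray t x) * ennreal (sinh t ^ (DIM('a) - 1)) * indicator {0<..} t \<partial>lborel)
    = (\<integral>\<^sup>+\<rho>. F (\<rho> *\<^sub>R x) * ennreal (\<rho> ^ (DIM('a) - 1) * norm x ^ DIM('a)) * indicator {0<..} \<rho> \<partial>lborel)"
proof -
  define M where "M = DIM('a) - 1"
  have N: "DIM('a) = Suc M" using DIM_positive[where 'a='a] by (simp add: M_def)
  define g where "g r = f (r *\<^sub>R sgn x) * ennreal ((2 / (1 - r\<^sup>2)) ^ Suc M * r ^ M)" for r
  have [measurable]: "g \<in> borel_measurable borel" unfolding g_def by measurable
  have "(\<integral>\<^sup>+t. f (ray t x) * ennreal (sinh t ^ M) * indicator {0<..} t \<partial>lborel)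
    = (\<integral>\<^sup>+t. g (tanh (t / 2)) * ennreal ((1 - (tanh (t / 2))\<^sup>2) / 2) * indicator {0<..} t \<partial>lborel)"
  proof (intro nn_integral_cong)
    fix t :: real
    show "f (ray t x) * ennreal (sinh t ^ M) * indicator {0<..} t
      = g (tanh (t / 2)) * ennreal ((1 - (tanh (t / 2))\<^sup>2) / 2) * indicator {0<..} t"
    proof (cases "t > 0")
      case True
      define r where "r = tanh (t / 2)"
      have r: "0 < r" "r < 1" using True tanh_real_lt_1[of "t/2"] by (auto simp: r_def)
      then have r2: "r\<^sup>2 < 1" by (simp add: abs_square_less_1)
      \<comment> \<open>One of the \<open>Suc M\<close> conformal factors is cancelled by the
        derivative of tanh (t/2); the others combine with \<open>r ^ M\<close> to
        \<open>sinh t ^ M\<close>.\<close>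
      have "(2 / (1 - r\<^sup>2)) ^ Suc M * r ^ M * ((1 - r\<^sup>2) / 2) = (2 / (1 - r\<^sup>2)) ^ M * r ^ M"
        using r2 by simp
      also have "\<dots> = sinh t ^ M"
        unfolding sinh_eq_tanh_half[of t] r_def[symmetric] power_mult_distrib[symmetric] by simp
      finally have "ennreal ((2 / (1 - r\<^sup>2)) ^ Suc M * r ^ M) * ennreal ((1 - r\<^sup>2) / 2) = ennreal (sinh t ^ M)"
        using r r2 by (subst ennreal_mult[symmetric]) auto
      then show ?thesis unfolding g_def ray_def r_def[symmetric] by (simp add: mult.assoc)
    qed simp
  qed
  also have "\<dots> = (\<integral>\<^sup>+r. g r * indicator {0<..<1} r \<partial>lborel)"
    by (rule nn_integral_tanh_substitution[symmetric]) measurable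
  also have "\<dots> = ennreal \<bar>norm x\<bar> * (\<integral>\<^sup>+\<rho>. g (0 + norm x * \<rho>) * indicator {0<..<1} (0 + norm x * \<rho>) \<partial>lborel)"
    using x by (intro nn_integral_real_affine) auto
  also have "\<dots> = (\<integral>\<^sup>+\<rho>. ennreal (norm x) * (g (norm x * \<rho>) * indicator {0<..<1} (norm x * \<rho>)) \<partial>lborel)"
    by (subst nn_integral_cmult) auto
  also have "\<dots> = (\<integral>\<^sup>+\<rho>. F (\<rho> *\<^sub>R x) * ennreal (\<rho> ^ M * norm x ^ Suc M) * indicator {0<..} \<rho> \<partial>lborel)"
  proof (intro nn_integral_cong)
    fix \<rho> :: real
    show "ennreal (norm x) * (g (norm x * \<rho>) * indicator {0<..<1} (norm x * \<rho>))
      = F (\<rho> *\<^sub>R x) * ennreal (\<rho> ^ M * norm x ^ Suc M) * indicator {0<..} \<rho>"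
    proof (cases "\<rho> > 0 \<and> norm x * \<rho> < 1")
      case True
      have d: "hdens (\<rho> *\<^sub>R x) = (2 / (1 - (norm x * \<rho>)\<^sup>2)) ^ Suc M"
        unfolding hdens_def hconf_def N using True by (simp add: mult.commute)
      have sq: "(norm x * \<rho>)\<^sup>2 < 1" using True by (simp add: abs_square_less_1)
      have "ennreal (norm x) * ennreal ((2 / (1 - (norm x * \<rho>)\<^sup>2)) ^ Suc M * (norm x * \<rho>) ^ M)
        = ennreal (hdens (\<rho> *\<^sub>R x)) * ennreal (\<rho> ^ M * norm x ^ Suc M)"
        unfolding d using True sq
        by (subst (1 2) ennreal_mult[symmetric]) (auto simp: power_mult_distrib mult_ac)
      moreover have "(norm x * \<rho>) *\<^sub>R sgn x = \<rho> *\<^sub>R x"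
        using x by (simp add: sgn_div_norm)
      moreover have "indicator {0<..<1} (norm x * \<rho>) = (1 :: ennreal)"
        "indicator {0<..} \<rho> = (1 :: ennreal)" "indicator (ball 0 1) (\<rho> *\<^sub>R x) = (1 :: ennreal)"
        using True x by (auto simp: mult.commute)
      ultimately show ?thesis unfolding g_def F_def
        by (simp only: mult_1_right) (metis mult.assoc mult.commute)
    next
      case False
      then have "\<rho> \<le> 0 \<or> norm x * \<rho> \<ge> 1" by auto
      then show ?thesis
        using x by (auto simp: F_def indicator_def mult.commute zero_less_mult_iff)
    qed
  qed
  finally show ?thesis unfolding N M_def[symmetric] by simp
qed

text \<open>Dilations replace polar coordinates: the annulus parametrises the rays.\<close>

lemma nn_integral_rays:
  fixes f :: "'a::euclidean_space \<Rightarrow> ennreal"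
  assumes [measurable]: "f \<in> borel_measurable borel"
  shows "(\<integral>\<^sup>+x. (\<integral>\<^sup>+t. f (ray t x) * ennreal (sinh t ^ (DIM('a) - 1)) * indicator {0<..} t \<partial>lborel) * indicator annulus x \<partial>lborel)
    = ray_const DIM('a) * (\<integral>\<^sup>+y. f y * ennreal (hdens y) * indicator (ball 0 1) y \<partial>lborel)"
proof -
  define N where "N = DIM('a)"
  have N: "N > 0" by (simp add: N_def)
  define F where "F y = f y * ennreal (hdens y) * indicator (ball 0 1) y" for y
  have [measurable]: "ball (0::'a) 1 \<in> sets borel" by simp
  have [measurable]: "F \<in> borel_measurable borel" unfolding F_def by measurable
  have "(\<integral>\<^sup>+x. (\<integral>\<^sup>+t. f (ray t x) * ennreal (sinh t ^ (N - 1)) * indicator {0<..} t \<partial>lborel) * indicator annulus x \<partial>lborel)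
    = (\<integral>\<^sup>+x. (\<integral>\<^sup>+\<rho>. F (\<rho> *\<^sub>R x) * ennreal (\<rho> ^ (N - 1) * norm x ^ N) * indicator {0<..} \<rho> * indicator annulus x \<partial>lborel) \<partial>lborel)"
  proof (intro nn_integral_cong)
    fix x :: 'a
    show "(\<integral>\<^sup>+t. f (ray t x) * ennreal (sinh t ^ (N - 1)) * indicator {0<..} t \<partial>lborel) * indicator annulus x
      = (\<integral>\<^sup>+\<rho>. F (\<rho> *\<^sub>R x) * ennreal (\<rho> ^ (N - 1) * norm x ^ N) * indicator {0<..} \<rho> * indicator annulus x \<partial>lborel)"
    proof (cases "x \<in> annulus")
      case True
      then have "x \<noteq> 0" by (auto simp: annulus_def)
      then show ?thesis using True nn_integral_single_ray[of f x] unfolding N_def F_def by simp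
    qed simp
  qed
  \<comment> \<open>For fixed \<rho> the substitution y = \<rho> x removes \<rho> from the argument
    of \<open>F\<close>. A second exchange then leaves, for each y, an integral over dilations
    alone.\<close>
  also have "\<dots> = (\<integral>\<^sup>+\<rho>. (\<integral>\<^sup>+x. F (\<rho> *\<^sub>R x) * ennreal (\<rho> ^ (N - 1) * norm x ^ N) * indicator {0<..} \<rho> * indicator annulus x \<partial>lborel) \<partial>lborel)"
    by (rule lborel_pair.Fubini'[symmetric]) measurable
  also have "\<dots> = (\<integral>\<^sup>+\<rho>. (\<integral>\<^sup>+y. F y * (ennreal ((1 / \<rho>) * (norm y / \<rho>) ^ N) * indicator annulus ((1 / \<rho>) *\<^sub>R y) * indicator {0<..} \<rho>) \<partial>lborel) \<partial>lborel)"
  proof (rule nn_integral_cong)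
    fix \<rho> :: real
    show "(\<integral>\<^sup>+x. F (\<rho> *\<^sub>R x) * ennreal (\<rho> ^ (N - 1) * norm x ^ N) * indicator {0<..} \<rho> * indicator annulus x \<partial>lborel)
      = (\<integral>\<^sup>+y. F y * (ennreal ((1 / \<rho>) * (norm y / \<rho>) ^ N) * indicator annulus ((1 / \<rho>) *\<^sub>R y) * indicator {0<..} \<rho>) \<partial>lborel)"
    proof (cases "\<rho> > 0")
      case True
      have "(\<integral>\<^sup>+y. F y * (ennreal ((1 / \<rho>) * (norm y / \<rho>) ^ N) * indicator annulus ((1 / \<rho>) *\<^sub>R y) * indicator {0<..} \<rho>) \<partial>lborel)
        = (\<integral>\<^sup>+x. ennreal (\<rho> ^ N) * (F (\<rho> *\<^sub>R x) * (ennreal ((1 / \<rho>) * (norm (\<rho> *\<^sub>R x) / \<rho>) ^ N) * indicator annulus ((1 / \<rho>) *\<^sub>R (\<rho> *\<^sub>R x)) * indicator {0<..} \<rho>)) \<partial>lborel)"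
        unfolding N_def by (rule nn_integral_scaleR[OF _ True]) measurable
      also have "\<dots> = (\<integral>\<^sup>+x. F (\<rho> *\<^sub>R x) * ennreal (\<rho> ^ (N - 1) * norm x ^ N) * indicator {0<..} \<rho> * indicator annulus x \<partial>lborel)"
      proof (intro nn_integral_cong)
        fix x :: 'a
        \<comment> \<open>The Jacobian of y = \<rho> x has one power of \<rho> more than the polar
          weight, whence the factor \<open>1 / \<rho>\<close>. \<open>N > 0\<close> makes the
          subtraction exact.\<close>
        have "\<rho> ^ N * (1 / \<rho>) = \<rho> ^ (N - 1)"
          using N True by (cases N) auto
        then have "\<rho> ^ N * ((1 / \<rho>) * norm x ^ N) = \<rho> ^ (N - 1) * norm x ^ N"
          by (metis mult.assoc)
        then have "ennreal (\<rho> ^ N) * ennreal ((1 / \<rho>) * (norm (\<rho> *\<^sub>R x) / \<rho>) ^ N) = ennreal (\<rho> ^ (N - 1) * norm x ^ N)"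
          using True by (subst ennreal_mult[symmetric]) auto
        then have "F (\<rho> *\<^sub>R x) * (ennreal (\<rho> ^ N) * ennreal ((1 / \<rho>) * (norm (\<rho> *\<^sub>R x) / \<rho>) ^ N)) * indicator {0<..} \<rho> * indicator annulus x
          = F (\<rho> *\<^sub>R x) * ennreal (\<rho> ^ (N - 1) * norm x ^ N) * indicator {0<..} \<rho> * indicator annulus x"
          by (simp only:)
        moreover have "(1 / \<rho>) *\<^sub>R (\<rho> *\<^sub>R x) = x" using True by simp
        ultimately show "ennreal (\<rho> ^ N) * (F (\<rho> *\<^sub>R x) * (ennreal ((1 / \<rho>) * (norm (\<rho> *\<^sub>R x) / \<rho>) ^ N) * indicator annulus ((1 / \<rho>) *\<^sub>R (\<rho> *\<^sub>R x)) * indicator {0<..} \<rho>))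
          = F (\<rho> *\<^sub>R x) * ennreal (\<rho> ^ (N - 1) * norm x ^ N) * indicator {0<..} \<rho> * indicator annulus x"
          by (simp only: mult_ac)
      qed
      finally show ?thesis by simp
    qed simp
  qed
  also have "\<dots> = (\<integral>\<^sup>+y. (\<integral>\<^sup>+\<rho>. F y * (ennreal ((1 / \<rho>) * (norm y / \<rho>) ^ N) * indicator annulus ((1 / \<rho>) *\<^sub>R y) * indicator {0<..} \<rho>) \<partial>lborel) \<partial>lborel)"
    by (rule lborel_pair.Fubini') measurable
  also have "\<dots> = (\<integral>\<^sup>+y. F y * (\<integral>\<^sup>+\<rho>. ennreal ((1 / \<rho>) * (norm y / \<rho>) ^ N) * indicator annulus ((1 / \<rho>) *\<^sub>R y) * indicator {0<..} \<rho> \<partial>lborel) \<partial>lborel)"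
    by (rule nn_integral_cong, rule nn_integral_cmult) measurable
  also have "\<dots> = (\<integral>\<^sup>+y. ray_const N * F y \<partial>lborel)"
  \<comment> \<open>At y = 0 the inner integral is 0 instead of \<open>ray_const N\<close>, but a
    point is null.\<close>
  proof (rule nn_integral_cong_AE, rule AE_mp[OF AE_lborel_singleton[of "0::'a"]], intro AE_I2 impI)
    fix y :: 'a assume "y \<noteq> 0"
    from nn_integral_annulus_dilations[OF this, of N]
    show "F y * (\<integral>\<^sup>+\<rho>. ennreal ((1 / \<rho>) * (norm y / \<rho>) ^ N) * indicator annulus ((1 / \<rho>) *\<^sub>R y) * indicator {0<..} \<rho> \<partial>lborel)
      = ray_const N * F y"
      by (simp only: mult.commute)
  qed
  also have "\<dots> = ray_const N * (\<integral>\<^sup>+y. F y \<partial>lborel)"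
    by (rule nn_integral_cmult) measurable
  finally show ?thesis unfolding N_def F_def .
qed

section \<open>Convergence in weighted Lebesgue spaces\<close>

lemma sinh_measurable[measurable]: "(sinh :: real \<Rightarrow> real) \<in> borel_measurable borel"
  by (intro borel_measurable_continuous_onI continuous_on_sinh continuous_on_id)

text \<open>For z > d write z = z^(1-p) z^p and use that z^(1-p) decreases in z, or is constant for
  p = 1. The free threshold d replaces the Hoelder inequality.\<close>

lemma le_add_powr:
  fixes z d p :: real
  assumes "p \<ge> 1" "d > 0" "z \<ge> 0"
  shows "z \<le> d + d powr (1 - p) * z powr p"
proof (cases "z \<le> d")
  case True
  then show ?thesis using assms by (simp add: add_increasing2)
next
  case False
  then have z: "z > d" "z > 0" using assms by auto
  have "z = z powr (1 - p) * z powr p" using z by (simp add: powr_add[symmetric])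
  also have "\<dots> \<le> d powr (1 - p) * z powr p"
    using z assms by (intro mult_right_mono powr_mono2') auto
  finally show ?thesis using assms by linarith
qed

text \<open>On \<open>{a..b}\<close> the weight is at least \<open>sinh a ^ M > 0\<close>, so
  integrating \<open>le_add_powr\<close> gives the bound. A small d makes the first term small, and
  for that d a small c makes the second term small.\<close>

lemma weighted_Lp_imp_L1:
  fixes g :: "real \<Rightarrow> real"
  assumes [measurable]: "g \<in> borel_measurable borel"
    and p: "p \<ge> 1" and d: "d > 0" and a: "0 < a" "a \<le> b" and c: "c \<ge> 0"
    and fin: "(\<integral>\<^sup>+t. ennreal (\<bar>g t\<bar> powr p) * ennreal (sinh t ^ M) * indicator {0<..} t \<partial>lborel) \<le> ennreal c"
  shows "set_integrable lborel {a..b} g" (is ?A)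
    and "integral {a..b} (\<lambda>t. \<bar>g t\<bar>) \<le> d * (b - a) + d powr (1 - p) / sinh a ^ M * c" (is ?B)
proof -
  define C where "C = d powr (1 - p) / sinh a ^ M"
  have sa: "sinh a ^ M > 0" using a by simp
  have C: "C \<ge> 0" using sa by (simp add: C_def)
  have pw: "ennreal (\<bar>g t\<bar>) * indicator {a..b} t \<le>
      ennreal d * indicator {a..b} t + ennreal C * (ennreal (\<bar>g t\<bar> powr p) * ennreal (sinh t ^ M) * indicator {0<..} t)" for t
  proof (cases "t \<in> {a..b}")
    case True
    have "sinh a ^ M \<le> sinh t ^ M" using True a by (intro power_mono) auto
    then have "d powr (1 - p) * \<bar>g t\<bar> powr p \<le> C * (\<bar>g t\<bar> powr p * sinh t ^ M)"
      using sa by (simp add: C_def field_simps mult_right_mono)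
    then have "\<bar>g t\<bar> \<le> d + C * (\<bar>g t\<bar> powr p * sinh t ^ M)"
      using le_add_powr[OF p d, of "\<bar>g t\<bar>"] by simp
    then have "ennreal \<bar>g t\<bar> \<le> ennreal (d + C * (\<bar>g t\<bar> powr p * sinh t ^ M))" by (rule ennreal_leI)
    also have "\<dots> = ennreal d + ennreal C * (ennreal (\<bar>g t\<bar> powr p) * ennreal (sinh t ^ M))"
      using d C True a by (simp add: ennreal_plus ennreal_mult)
    finally show ?thesis using True a by simp
  qed simp
  have "(\<integral>\<^sup>+t. ennreal (\<bar>g t\<bar>) * indicator {a..b} t \<partial>lborel)
     \<le> (\<integral>\<^sup>+t. ennreal d * indicator {a..b} t + ennreal C * (ennreal (\<bar>g t\<bar> powr p) * ennreal (sinh t ^ M) * indicator {0<..} t) \<partial>lborel)"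
    using pw by (intro nn_integral_mono)
  also have "\<dots> = ennreal d * ennreal (b - a) + ennreal C * (\<integral>\<^sup>+t. ennreal (\<bar>g t\<bar> powr p) * ennreal (sinh t ^ M) * indicator {0<..} t \<partial>lborel)"
    using a by (subst nn_integral_add) (auto simp: nn_integral_cmult nn_integral_cmult_indicator)
  also have "\<dots> \<le> ennreal d * ennreal (b - a) + ennreal C * ennreal c"
    using fin by (intro add_left_mono mult_left_mono) auto
  also have "\<dots> = ennreal (d * (b - a) + C * c)"
    using d a C c by (simp add: ennreal_plus ennreal_mult)
  finally have nn: "(\<integral>\<^sup>+t. ennreal (\<bar>g t\<bar>) * indicator {a..b} t \<partial>lborel) \<le> ennreal (d * (b - a) + C * c)" .
  have eq: "ennreal (norm (indicator {a..b} t *\<^sub>R g t)) = ennreal (\<bar>g t\<bar>) * indicator {a..b} t" for t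
    by (simp split: split_indicator)
  show int: ?A
    unfolding set_integrable_def
  proof (rule integrableI_bounded)
    show "(\<integral>\<^sup>+t. ennreal (norm (indicator {a..b} t *\<^sub>R g t)) \<partial>lborel) < \<infinity>"
      unfolding eq using nn by (simp add: le_less_trans)
  qed simp
  have int': "set_integrable lborel {a..b} (\<lambda>t. \<bar>g t\<bar>)" using int by (rule set_integrable_abs)
  have "ennreal (LINT t:{a..b}|lborel. \<bar>g t\<bar>) = (\<integral>\<^sup>+t. ennreal (indicator {a..b} t *\<^sub>R \<bar>g t\<bar>) \<partial>lborel)"
    using int' unfolding set_lebesgue_integral_def set_integrable_def
    by (intro nn_integral_eq_integral[symmetric]) auto
  also have "\<dots> = (\<integral>\<^sup>+t. ennreal (\<bar>g t\<bar>) * indicator {a..b} t \<partial>lborel)"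
    by (intro nn_integral_cong) (simp split: split_indicator)
  finally have "ennreal (LINT t:{a..b}|lborel. \<bar>g t\<bar>) \<le> ennreal (d * (b - a) + C * c)" using nn by simp
  then have "(LINT t:{a..b}|lborel. \<bar>g t\<bar>) \<le> d * (b - a) + C * c"
    using d a C c by (subst (asm) ennreal_le_iff) auto
  then show ?B using set_borel_integral_eq_integral(2)[OF int'] by (simp add: C_def)
qed

text \<open>A nonempty compact subset of \<open>ival R\<close> lies between its minimum, which is
  positive, and its maximum.\<close>

lemma loc_integrable_weighted_Lp:
  fixes g :: "real \<Rightarrow> real"
  assumes g: "g \<in> borel_measurable borel" and p: "p \<ge> 1"
    and fin: "(\<integral>\<^sup>+t. ennreal (\<bar>g t\<bar> powr p) * ennreal (sinh t ^ M) * indicator {0<..} t \<partial>lborel) < \<infinity>"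
  shows "loc_integrable R g"
  unfolding loc_integrable_def
proof (intro allI impI)
  fix K assume K: "compact K \<and> K \<subseteq> ival R"
  obtain c where c: "c \<ge> 0" "(\<integral>\<^sup>+t. ennreal (\<bar>g t\<bar> powr p) * ennreal (sinh t ^ M) * indicator {0<..} t \<partial>lborel) = ennreal c"
    using fin by (cases "\<integral>\<^sup>+t. ennreal (\<bar>g t\<bar> powr p) * ennreal (sinh t ^ M) * indicator {0<..} t \<partial>lborel" rule: ennreal_cases) auto
  show "set_integrable lborel K g"
  proof (cases "K = {}")
    case False
    obtain a where a: "a \<in> K" "\<And>t. t \<in> K \<Longrightarrow> a \<le> t" using compact_attains_inf[of K] K False by blast
    obtain b where b: "b \<in> K" "\<And>t. t \<in> K \<Longrightarrow> t \<le> b" using compact_attains_sup[of K] K False by blast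
    have "0 < a" "a \<le> b" using a b K by (auto simp: ival_def)
    then have "set_integrable lborel {a..b} g"
      using weighted_Lp_imp_L1(1)[OF g p, of 1 a b c M] c by simp
    then show ?thesis
      by (rule set_integrable_subset) (use a b K borel_compact in auto)
  qed (simp add: set_integrable_def)
qed

text \<open>One index must serve function and derivative together, but it may depend on the
  tolerance; this is all that a vanishing liminf of the summed errors provides.\<close>

lemma approx_deriv_weighted_Lp:
  fixes g0 g1 :: "real \<Rightarrow> real" and F0 F1 :: "nat \<Rightarrow> real \<Rightarrow> real"
  assumes meas[measurable]: "g0 \<in> borel_measurable borel" "g1 \<in> borel_measurable borel"
      "\<And>n. F0 n \<in> borel_measurable borel" "\<And>n. F1 n \<in> borel_measurable borel"
    and p: "p \<ge> 1"
    and fin0: "(\<integral>\<^sup>+t. ennreal (\<bar>g0 t\<bar> powr p) * ennreal (sinh t ^ M) * indicator {0<..} t \<partial>lborel) < \<infinity>"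
    and fin1: "(\<integral>\<^sup>+t. ennreal (\<bar>g1 t\<bar> powr p) * ennreal (sinh t ^ M) * indicator {0<..} t \<partial>lborel) < \<infinity>"
    and conv: "\<And>e. e > 0 \<Longrightarrow> \<exists>n.
      (\<integral>\<^sup>+t. ennreal (\<bar>F0 n t - g0 t\<bar> powr p) * ennreal (sinh t ^ M) * indicator {0<..} t \<partial>lborel) \<le> ennreal e \<and>
      (\<integral>\<^sup>+t. ennreal (\<bar>F1 n t - g1 t\<bar> powr p) * ennreal (sinh t ^ M) * indicator {0<..} t \<partial>lborel) \<le> ennreal e"
    and der: "\<And>n t. t \<in> ival R \<Longrightarrow> (F0 n has_real_derivative F1 n t) (at t)"
    and cont: "\<And>n. continuous_on (ival R) (F1 n)"
  shows "approx_deriv R g0 g1"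
  unfolding approx_deriv_def
proof (intro conjI allI impI)
  show "loc_integrable R g0" "loc_integrable R g1"
    using loc_integrable_weighted_Lp[OF meas(1) p fin0] loc_integrable_weighted_Lp[OF meas(2) p fin1] by auto
  fix a b e :: real
  assume H: "0 < a \<and> a < b \<and> ereal b < R \<and> 0 < e"
  have sub: "{a..b} \<subseteq> ival R"
    using H unfolding ival_def by auto (metis ereal_less_eq(3) order_le_less_trans)
  \<comment> \<open>\<open>d\<close> comes before \<open>c\<close> because \<open>C\<close> depends
    on it; each of the two error terms then equals \<open>e / 4\<close>.\<close>
  define d where "d = e / (4 * (b - a))"
  define C where "C = d powr (1 - p) / sinh a ^ M"
  have d: "d > 0" using H by (simp add: d_def)
  have "sinh a ^ M > 0" using H by simp
  then have C: "C > 0" using d by (simp add: C_def)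
  define c where "c = e / (4 * C)"
  have c: "c > 0" using H C by (simp add: c_def)
  have bnd: "d * (b - a) + C * c < e"
  proof -
    have "b - a \<noteq> 0" using H by simp
    then have "d * (b - a) = e / 4" unfolding d_def by (metis divide_divide_eq_left divide_divide_eq_left' nonzero_eq_divide_eq)
    moreover have "C * c = e / 4" using C by (simp add: c_def)
    ultimately show ?thesis using H by simp
  qed
  obtain n where n0: "(\<integral>\<^sup>+t. ennreal (\<bar>F0 n t - g0 t\<bar> powr p) * ennreal (sinh t ^ M) * indicator {0<..} t \<partial>lborel) \<le> ennreal c"
    and n1: "(\<integral>\<^sup>+t. ennreal (\<bar>F1 n t - g1 t\<bar> powr p) * ennreal (sinh t ^ M) * indicator {0<..} t \<partial>lborel) \<le> ennreal c"
    using conv[OF c] by blast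
  have 0: "integral {a..b} (\<lambda>t. \<bar>F0 n t - g0 t\<bar>) < e"
    using weighted_Lp_imp_L1(2)[OF _ p d _ _ _ n0, of a b] H c bnd by (simp add: C_def[symmetric])
  have 1: "integral {a..b} (\<lambda>t. \<bar>F1 n t - g1 t\<bar>) < e"
    using weighted_Lp_imp_L1(2)[OF _ p d _ _ _ n1, of a b] H c bnd by (simp add: C_def[symmetric])
  have "(\<forall>t\<in>{a..b}. (F0 n has_real_derivative F1 n t) (at t)) \<and> continuous_on {a..b} (F1 n) \<and>
        integral {a..b} (\<lambda>t. \<bar>F0 n t - g0 t\<bar>) < e \<and> integral {a..b} (\<lambda>t. \<bar>F1 n t - g1 t\<bar>) < e"
    using der sub 0 1 continuous_on_subset[OF cont sub] by blast
  then show "\<exists>F F'. (\<forall>t\<in>{a..b}. (F has_real_derivative F' t) (at t)) \<and> continuous_on {a..b} F' \<and>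
        integral {a..b} (\<lambda>t. \<bar>F t - g0 t\<bar>) < e \<and> integral {a..b} (\<lambda>t. \<bar>F' t - g1 t\<bar>) < e"
    by blast
qed

text \<open>The zeroth witness has to be \<open>v\<close> itself, which is known to agree with the
  contraction along a ray only on \<open>ival R\<close>.\<close>

lemma weak_deriv_cong:
  assumes "weak_deriv R f g" "\<And>t. t \<in> ival R \<Longrightarrow> f t = f' t"
  shows "weak_deriv R f' g"
proof -
  have "loc_integrable R f'"
    unfolding loc_integrable_def
  proof (intro allI impI)
    fix K assume K: "compact K \<and> K \<subseteq> ival R"
    then have "(\<lambda>t. indicator K t *\<^sub>R f t) = (\<lambda>t. indicator K t *\<^sub>R f' t)"
      using assms(2) by (intro ext) (auto simp: indicator_def)
    moreover have "set_integrable lborel K f"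
      using assms(1) K unfolding weak_deriv_def loc_integrable_def by blast
    ultimately show "set_integrable lborel K f'" unfolding set_integrable_def by simp
  qed
  moreover have "set_lebesgue_integral lborel (ival R) (\<lambda>t. f t * \<phi> t)
      = set_lebesgue_integral lborel (ival R) (\<lambda>t. f' t * \<phi> t)" for \<phi>
    unfolding set_lebesgue_integral_def using assms(2)
    by (intro Bochner_Integration.integral_cong) (auto simp: indicator_def)
  ultimately show ?thesis using assms(1) unfolding weak_deriv_def by simp
qed

text \<open>The components are measurable only on S, so each one is extended by 0; the norm factors
  and directions are Borel on the whole space.\<close>

lemma radial_part_measurable:
  fixes T :: "'a::euclidean_space \<Rightarrow> 'a list \<Rightarrow> real"
  assumes "S \<in> sets borel"
    and "\<And>is. is \<in> idx j \<Longrightarrow> set_borel_measurable lborel S (\<lambda>x. T x is)"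
  shows "(\<lambda>x. if x \<in> S then radial_part j (T x) x else 0) \<in> borel_measurable borel"
proof -
  have "(\<lambda>x. ((1 - (norm x)^2) / 2) ^ j * (\<Sum>is\<in>idx j. (indicator S x *\<^sub>R T x is) * (\<Prod>m<j. (x /\<^sub>R norm x) \<bullet> is ! m)))
      \<in> borel_measurable borel"
    using assms(2) unfolding set_borel_measurable_def
    by (intro borel_measurable_times borel_measurable_sum borel_measurable_prod) auto
  moreover have "(\<lambda>x. ((1 - (norm x)^2) / 2) ^ j * (\<Sum>is\<in>idx j. (indicator S x *\<^sub>R T x is) * (\<Prod>m<j. (x /\<^sub>R norm x) \<bullet> is ! m)))
     = (\<lambda>x. if x \<in> S then radial_part j (T x) x else 0)"
    unfolding radial_part_def sgn_div_norm by (auto simp: indicator_def)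
  ultimately show ?thesis by simp
qed

lemma powr_add_le:
  fixes a b p :: real
  assumes "p \<ge> 0" "a \<ge> 0" "b \<ge> 0"
  shows "(a + b) powr p \<le> 2 powr p * (a powr p + b powr p)"
proof -
  have "(a + b) powr p \<le> (2 * max a b) powr p"
    using assms by (intro powr_mono2) auto
  also have "\<dots> = 2 powr p * max a b powr p" using assms by (simp add: powr_mult)
  also have "max a b powr p \<le> a powr p + b powr p" by (auto simp: max_def)
  finally show ?thesis by (simp add: mult_left_mono)
qed

lemma hdist_measurable[measurable]: "hdist \<in> borel_measurable borel"
  unfolding hdist_def[abs_def] by measurable

lemma hdens_pos: "x \<in> ball 0 1 \<Longrightarrow> hdens x > 0"
  unfolding hdens_def hconf_def by (simp add: abs_square_less_1)

section \<open>The radial Sobolev inequality\<close>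

theorem theorem1p1:
  fixes G :: "nat \<Rightarrow> 'a::euclidean_space \<Rightarrow> 'a list \<Rightarrow> real"
    and v :: "real \<Rightarrow> real" and k :: nat and p :: real and R :: ereal
  assumes "k \<ge> 1" and "p \<ge> 1" and "R > 0"
    and "hsobolev k p R G"
    and "\<forall>x\<in>hball R - {0}. G 0 x [] = v (hdist x)"
  shows "wsobolev k p R DIM('a) v \<and>
    (\<exists>w. wsob_witness k p R DIM('a) v w \<and>
       (AE x in lborel. x \<in> hball R - {0} \<longrightarrow> \<bar>w k (hdist x)\<bar> \<le> tnorm k (G k x) x))"
proof -
  let ?B = "hball R :: 'a set"
  define M where "M = DIM('a) - 1"
  have p: "p \<ge> 0" using assms(2) by simp
  have B[measurable]: "?B \<in> sets borel" using open_hball by (rule borel_open)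
  have Bball: "norm x < 1" if "x \<in> ?B" for x using that by (auto simp: hball_def)
  obtain s where Gm: "\<And>j is. j \<le> k \<Longrightarrow> set_borel_measurable lborel ?B (\<lambda>x. G j x is)"
    and s: "\<And>n. hsmooth_class k p R (s n)"
    and lim: "\<And>j. j \<le> k \<Longrightarrow> (\<lambda>n. \<integral>\<^sup>+x\<in>?B. ennreal
             (tnorm j (\<lambda>is. cov is (s n) x - G j x is) x powr p * hdens x) \<partial>lborel) \<longlonglongrightarrow> 0"
    using assms(4) unfolding hsobolev_def by blast
  have sm: "smooth_on ?B (s n)" for n using s unfolding hsmooth_class_def by blast

  \<comment> \<open>Radial contractions of the limit tensors and, below, of the approximants,
    extended by 0 to Borel functions on the whole space. \<open>H 0\<close> is the given function
    u.\<close>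
  define H where "H j x = (if x \<in> ?B then radial_part j (G j x) x else 0)" for j x
  define h where "h n j x = (if x \<in> ?B then radial_part j (\<lambda>is. cov is (s n) x) x else 0)" for n j x
  have Hm[measurable]: "H j \<in> borel_measurable borel" if "j \<le> k" for j
    unfolding H_def[abs_def] by (rule radial_part_measurable[OF B Gm[OF that]])
  have hm[measurable]: "h n j \<in> borel_measurable borel" for n j
    unfolding h_def[abs_def]
  proof (rule radial_part_measurable[OF B])
    fix "is" :: "'a list" assume "is \<in> idx j"
    then have "set is \<subseteq> Basis" by (simp add: idx_def)
    from differentiable_imp_continuous_on[OF cov_differentiable_on[OF open_hball hball_subset_ball sm this]]
    show "set_borel_measurable lborel ?B (cov is (s n))"
      unfolding set_borel_measurable_def measurable_lborel2
      by (rule borel_measurable_continuous_on_indicator[OF B])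
  qed

  define E where "E n j = (\<integral>\<^sup>+y. ennreal (\<bar>h n j y - H j y\<bar> powr p) * ennreal (hdens y) * indicator (ball 0 1) y \<partial>lborel)" for n j
  have Elim: "(\<lambda>n. E n j) \<longlonglongrightarrow> 0" if j: "j \<le> k" for j
  proof (rule tendsto_sandwich[OF _ _ tendsto_const lim[OF j]])
    show "\<forall>\<^sub>F n in sequentially. E n j \<le> (\<integral>\<^sup>+x\<in>?B. ennreal
             (tnorm j (\<lambda>is. cov is (s n) x - G j x is) x powr p * hdens x) \<partial>lborel)"
      unfolding E_def
    proof (intro always_eventually allI nn_integral_mono)
      fix n and x :: 'a
      show "ennreal (\<bar>h n j x - H j x\<bar> powr p) * ennreal (hdens x) * indicator (ball 0 1) x
        \<le> ennreal (tnorm j (\<lambda>is. cov is (s n) x - G j x is) x powr p * hdens x) * indicator ?B x"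
      proof (cases "x \<in> ?B")
        case True
        have "h n j x - H j x = radial_part j (\<lambda>is. cov is (s n) x - G j x is) x"
          using True by (simp add: h_def H_def radial_part_diff)
        then have "\<bar>h n j x - H j x\<bar> powr p \<le> tnorm j (\<lambda>is. cov is (s n) x - G j x is) x powr p"
          using abs_radial_part_le_tnorm[OF Bball[OF True]] p by (intro powr_mono2) auto
        moreover have "hdens x > 0" using Bball[OF True] by (intro hdens_pos) simp
        ultimately show ?thesis
          using True Bball[OF True] by (simp add: ennreal_mult[symmetric] ennreal_leI mult_right_mono)
      qed (simp add: h_def H_def)
    qed
  qed simp
  have Efin: "(\<integral>\<^sup>+y. ennreal (\<bar>H j y\<bar> powr p) * ennreal (hdens y) * indicator (ball 0 1) y \<partial>lborel) < \<infinity>"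
    if j: "j \<le> k" for j
  proof -
    note [measurable] = Hm[OF j]
    have [measurable]: "ball (0::'a) 1 \<in> sets borel" by simp
    have "\<forall>\<^sub>F n in sequentially. E n j < 1" using Elim[OF j] by (rule order_tendstoD) simp
    then obtain n where n: "E n j < 1" by (auto simp: eventually_sequentially)
    \<comment> \<open>\<open>H j\<close> is within a finite L^p error of one approximant, whose own
      norm \<open>Z\<close> is finite because \<open>s n\<close> belongs to the generating
      class.\<close>
    define Z where "Z = (\<integral>\<^sup>+y. ennreal (\<bar>h n j y\<bar> powr p) * ennreal (hdens y) * indicator (ball 0 1) y \<partial>lborel)"
    have "Z \<le> (\<integral>\<^sup>+x. ennreal (norm (indicator ?B x *\<^sub>R (tnorm j (\<lambda>is. cov is (s n) x) x powr p * hdens x))) \<partial>lborel)"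
      unfolding Z_def
    proof (intro nn_integral_mono)
      fix x :: 'a
      show "ennreal (\<bar>h n j x\<bar> powr p) * ennreal (hdens x) * indicator (ball 0 1) x
        \<le> ennreal (norm (indicator ?B x *\<^sub>R (tnorm j (\<lambda>is. cov is (s n) x) x powr p * hdens x)))"
      proof (cases "x \<in> ?B")
        case True
        have "\<bar>h n j x\<bar> powr p \<le> tnorm j (\<lambda>is. cov is (s n) x) x powr p"
          using abs_radial_part_le_tnorm[OF Bball[OF True]] p True by (intro powr_mono2) (auto simp: h_def)
        moreover have "hdens x > 0" using Bball[OF True] by (intro hdens_pos) simp
        ultimately show ?thesis
          using True Bball[OF True] by (simp add: ennreal_mult[symmetric] ennreal_leI mult_right_mono abs_mult)
      qed (simp add: h_def)
    qed
    also have "\<dots> < \<infinity>"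
      using s[of n] j unfolding hsmooth_class_def set_integrable_def integrable_iff_bounded by blast
    finally have Z: "Z < \<infinity>" .
    have "(\<integral>\<^sup>+y. ennreal (\<bar>H j y\<bar> powr p) * ennreal (hdens y) * indicator (ball 0 1) y \<partial>lborel)
      \<le> (\<integral>\<^sup>+y. ennreal (2 powr p) * (ennreal (\<bar>h n j y - H j y\<bar> powr p) * ennreal (hdens y) * indicator (ball 0 1) y
          + ennreal (\<bar>h n j y\<bar> powr p) * ennreal (hdens y) * indicator (ball 0 1) y) \<partial>lborel)"
    proof (intro nn_integral_mono)
      fix y :: 'a
      have "\<bar>H j y\<bar> powr p \<le> (\<bar>h n j y - H j y\<bar> + \<bar>h n j y\<bar>) powr p"
        using p by (intro powr_mono2) auto
      also have "\<dots> \<le> 2 powr p * (\<bar>h n j y - H j y\<bar> powr p + \<bar>h n j y\<bar> powr p)"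
        using p by (intro powr_add_le) auto
      finally have "ennreal (\<bar>H j y\<bar> powr p) \<le> ennreal (2 powr p) * (ennreal (\<bar>h n j y - H j y\<bar> powr p) + ennreal (\<bar>h n j y\<bar> powr p))"
        by (simp add: ennreal_leI ennreal_mult[symmetric] ennreal_plus[symmetric] del: ennreal_plus)
      then have "ennreal (\<bar>H j y\<bar> powr p) * (ennreal (hdens y) * indicator (ball 0 1) y)
        \<le> ennreal (2 powr p) * (ennreal (\<bar>h n j y - H j y\<bar> powr p) + ennreal (\<bar>h n j y\<bar> powr p)) * (ennreal (hdens y) * indicator (ball 0 1) y)"
        by (rule mult_right_mono) simp
      then show "ennreal (\<bar>H j y\<bar> powr p) * ennreal (hdens y) * indicator (ball 0 1) y
        \<le> ennreal (2 powr p) * (ennreal (\<bar>h n j y - H j y\<bar> powr p) * ennreal (hdens y) * indicator (ball 0 1) y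
          + ennreal (\<bar>h n j y\<bar> powr p) * ennreal (hdens y) * indicator (ball 0 1) y)"
        by (simp only: distrib_left distrib_right mult.assoc)
    qed
    also have "\<dots> = ennreal (2 powr p) * (E n j + Z)"
      unfolding E_def Z_def by (subst nn_integral_cmult, measurable, subst nn_integral_add) measurable
    also have "\<dots> < \<infinity>"
    proof -
      have "E n j < \<infinity>" using n by (rule less_trans) simp
      then show ?thesis using Z by (simp add: ennreal_mult_less_top)
    qed
    finally show ?thesis .
  qed

  \<comment> \<open>Error and norm on the ray through \<open>x\<close>. By
    \<open>nn_integral_rays\<close> their integrals over the annulus are the corresponding integrals
    over the ball times \<open>ray_const\<close>.\<close>
  define e where "e n j x = (\<integral>\<^sup>+t. ennreal (\<bar>h n j (ray t x) - H j (ray t x)\<bar> powr p) * ennreal (sinh t ^ M) * indicator {0<..} t \<partial>lborel)" for n j x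
  define L where "L j x = (\<integral>\<^sup>+t. ennreal (\<bar>H j (ray t x)\<bar> powr p) * ennreal (sinh t ^ M) * indicator {0<..} t \<partial>lborel)" for j x
  have em[measurable]: "e n j \<in> borel_measurable borel" if "j \<le> k" for n j
  proof -
    note [measurable] = Hm[OF that]
    show ?thesis unfolding e_def[abs_def] by measurable
  qed
  have Lm[measurable]: "L j \<in> borel_measurable borel" if "j \<le> k" for j
  proof -
    note [measurable] = Hm[OF that]
    show ?thesis unfolding L_def[abs_def] by measurable
  qed
  have eint: "(\<integral>\<^sup>+x. e n j x * indicator annulus x \<partial>lborel) = ray_const DIM('a) * E n j" if "j \<le> k" for n j
    unfolding e_def E_def M_def
    by (rule nn_integral_rays) (use Hm[OF that] in measurable)
  have Lint: "(\<integral>\<^sup>+x. L j x * indicator annulus x \<partial>lborel) < \<infinity>" if "j \<le> k" for j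
  proof -
    have "(\<integral>\<^sup>+x. L j x * indicator annulus x \<partial>lborel)
      = ray_const DIM('a) * (\<integral>\<^sup>+y. ennreal (\<bar>H j y\<bar> powr p) * ennreal (hdens y) * indicator (ball 0 1) y \<partial>lborel)"
      unfolding L_def M_def by (rule nn_integral_rays) (use Hm[OF that] in measurable)
    then show ?thesis
      using Efin[OF that] ray_const_finite[of "DIM('a)"] by (simp add: ennreal_mult_less_top less_top)
  qed

  \<comment> \<open>A liminf, because integrals tending to 0 do not force pointwise convergence of
    the full sequence. The errors of all orders are summed so that one index is good for all of them
    simultaneously.\<close>
  define good where "good x \<longleftrightarrow> (\<forall>j\<le>k. L j x < \<infinity>) \<and> liminf (\<lambda>n. \<Sum>j\<le>k. e n j x) = 0" for x
  have AE_good: "AE x in lborel. x \<in> annulus \<longrightarrow> good x"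
  proof -
    have "AE x in lborel. \<forall>j\<in>{..k}. L j x * indicator annulus x \<noteq> \<infinity>"
    proof (subst AE_ball_countable, simp, intro ballI)
      fix j assume "j \<in> {..k}"
      then have j: "j \<le> k" by simp
      note [measurable] = Lm[OF j]
      show "AE x in lborel. L j x * indicator annulus x \<noteq> \<infinity>"
        by (rule nn_integral_PInf_AE) (use Lint[OF j] in auto)
    qed
    moreover have "AE x in lborel. liminf (\<lambda>n. (\<Sum>j\<le>k. e n j x) * indicator annulus x) = 0"
    proof -
      have sm: "(\<lambda>x. (\<Sum>j\<le>k. e n j x) * indicator annulus x) \<in> borel_measurable lborel" for n
        using em by (intro borel_measurable_times_ennreal borel_measurable_sum borel_measurable_indicator) auto
      have "(\<integral>\<^sup>+x. (\<Sum>j\<le>k. e n j x) * indicator annulus x \<partial>lborel) = (\<Sum>j\<le>k. ray_const DIM('a) * E n j)" for n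
      proof -
        have "(\<integral>\<^sup>+x. (\<Sum>j\<le>k. e n j x) * indicator annulus x \<partial>lborel)
          = (\<Sum>j\<le>k. \<integral>\<^sup>+x. e n j x * indicator annulus x \<partial>lborel)"
          unfolding sum_distrib_right using em
          by (intro nn_integral_sum borel_measurable_times_ennreal borel_measurable_indicator) auto
        then show ?thesis using eint by simp
      qed
      moreover have "(\<lambda>n. \<Sum>j\<le>k. ray_const DIM('a) * E n j) \<longlonglongrightarrow> (\<Sum>j\<le>k. ray_const DIM('a) * 0)"
        using ray_const_finite[of "DIM('a)"] Elim
        by (intro tendsto_sum ennreal_tendsto_cmult) (auto simp: less_top)
      ultimately have "(\<lambda>n. \<integral>\<^sup>+x. (\<Sum>j\<le>k. e n j x) * indicator annulus x \<partial>lborel) \<longlonglongrightarrow> 0" by simp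
      then have "liminf (\<lambda>n. \<integral>\<^sup>+x. (\<Sum>j\<le>k. e n j x) * indicator annulus x \<partial>lborel) = 0"
        by (intro lim_imp_Liminf) auto
      moreover have "(\<integral>\<^sup>+x. liminf (\<lambda>n. (\<Sum>j\<le>k. e n j x) * indicator annulus x) \<partial>lborel)
        \<le> liminf (\<lambda>n. \<integral>\<^sup>+x. (\<Sum>j\<le>k. e n j x) * indicator annulus x \<partial>lborel)"
        by (rule nn_integral_liminf) (rule sm)
      ultimately have "(\<integral>\<^sup>+x. liminf (\<lambda>n. (\<Sum>j\<le>k. e n j x) * indicator annulus x) \<partial>lborel) = 0" by simp
      moreover have "(\<lambda>x. liminf (\<lambda>n. (\<Sum>j\<le>k. e n j x) * indicator annulus x)) \<in> borel_measurable lborel"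
        using sm by (rule borel_measurable_liminf)
      ultimately show ?thesis by (simp add: nn_integral_0_iff_AE)
    qed
    ultimately show ?thesis
    proof eventually_elim
      case (elim x)
      show ?case
      proof
        assume x: "x \<in> annulus"
        show "good x" unfolding good_def using elim x by (auto simp: less_top)
      qed
    qed
  qed

  have ray_ball: "ray t x \<in> ?B \<longleftrightarrow> t \<in> ival R" if "x \<noteq> 0" "t > 0" for t and x :: 'a
  proof
    assume "ray t x \<in> ?B"
    then show "t \<in> ival R" using hdist_ray[of x t] that by (simp add: hball_def ival_def)
  qed (use ray_in_hball[of x t R] that in auto)
  \<comment> \<open>The radial form of u is assumed at every point but the origin, so at order 0 all
    rays agree for every t in \<open>ival R\<close>.\<close>
  have H0: "H 0 (ray t x) = v t" if "x \<noteq> 0" "t \<in> ival R" for t x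
  proof -
    have r: "ray t x \<in> ?B - {0}" by (rule ray_in_hball[OF that])
    have "t > 0" using that by (simp add: ival_def)
    then have "hdist (ray t x) = t" using hdist_ray[of x t] that by simp
    then have "G 0 (ray t x) [] = v t" using assms(5) r by metis
    then show ?thesis using r by (simp add: H_def radial_part_def idx_0)
  qed
  have ival_open: "open (ival R)"
  proof -
    have "ival R = {0<..} \<inter> ereal -` {..<R}" by (auto simp: ival_def)
    then show ?thesis using open_ereal_vimage[of "{..<R}"] by auto
  qed

  have approx: "approx_deriv R (\<lambda>t. H j (ray t x)) (\<lambda>t. H (Suc j) (ray t x))"
    if x: "x \<in> annulus" "good x" and j: "j < k" for x j
  proof (rule approx_deriv_weighted_Lp[where p=p and M=M and ?F0.0="\<lambda>n t. h n j (ray t x)" and ?F1.0="\<lambda>n t. h n (Suc j) (ray t x)"])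
    have x0: "x \<noteq> 0" using x by (auto simp: annulus_def)
    have j': "j \<le> k" "Suc j \<le> k" using j by auto
    note [measurable] = Hm[OF j'(1)] Hm[OF j'(2)]
    show "(\<lambda>t. H j (ray t x)) \<in> borel_measurable borel" "(\<lambda>t. H (Suc j) (ray t x)) \<in> borel_measurable borel"
      "(\<lambda>t. h n j (ray t x)) \<in> borel_measurable borel" "(\<lambda>t. h n (Suc j) (ray t x)) \<in> borel_measurable borel" for n
      by measurable
    show "p \<ge> 1" by (rule assms(2))
    show "(\<integral>\<^sup>+t. ennreal (\<bar>H j (ray t x)\<bar> powr p) * ennreal (sinh t ^ M) * indicator {0<..} t \<partial>lborel) < \<infinity>"
      "(\<integral>\<^sup>+t. ennreal (\<bar>H (Suc j) (ray t x)\<bar> powr p) * ennreal (sinh t ^ M) * indicator {0<..} t \<partial>lborel) < \<infinity>"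
      using x j' unfolding good_def L_def by auto
    show "\<exists>n. (\<integral>\<^sup>+t. ennreal (\<bar>h n j (ray t x) - H j (ray t x)\<bar> powr p) * ennreal (sinh t ^ M) * indicator {0<..} t \<partial>lborel) \<le> ennreal c \<and>
      (\<integral>\<^sup>+t. ennreal (\<bar>h n (Suc j) (ray t x) - H (Suc j) (ray t x)\<bar> powr p) * ennreal (sinh t ^ M) * indicator {0<..} t \<partial>lborel) \<le> ennreal c"
      if c: "c > 0" for c
    proof -
      have "\<exists>n. (\<Sum>j\<le>k. e n j x) < ennreal c"
      proof (rule ccontr)
        assume "\<not> ?thesis"
        then have "ennreal c \<le> liminf (\<lambda>n. \<Sum>j\<le>k. e n j x)"
          by (intro Liminf_bounded always_eventually allI) (auto simp: not_less)
        then show False using x c unfolding good_def by (simp add: ennreal_eq_0_iff)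
      qed
      then obtain n where n: "(\<Sum>j\<le>k. e n j x) < ennreal c" by blast
      have "e n i x \<le> ennreal c" if "i \<le> k" for i
      proof -
        have "e n i x \<le> (\<Sum>j\<le>k. e n j x)" using that by (intro member_le_sum) auto
        then show ?thesis using n by simp
      qed
      then show ?thesis using j' unfolding e_def by blast
    qed
    have der: "((\<lambda>t. h n i (ray t x)) has_real_derivative h n (Suc i) (ray t x)) (at t)"
      if t: "t \<in> ival R" for n t i
    proof -
      have tpos: "t > 0" using t by (simp add: ival_def)
      have rB: "ray t x \<in> ?B" using ray_in_hball[OF x0 t] by simp
      have "((\<lambda>t. radial_part i (\<lambda>is. cov is (s n) (ray t x)) (ray t x)) has_real_derivative
         h n (Suc i) (ray t x)) (at t)"
        using radial_part_cov_has_derivative[OF open_hball hball_subset_ball sm x0 tpos rB, of i n] rB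
        by (simp add: h_def)
      then show ?thesis
      proof (rule has_field_derivative_transform_within_open[OF _ ival_open t])
        fix r assume r: "r \<in> ival R"
        then show "radial_part i (\<lambda>is. cov is (s n) (ray r x)) (ray r x) = h n i (ray r x)"
          using ray_in_hball[OF x0 r] by (simp add: h_def)
      qed
    qed
    show "((\<lambda>t. h n j (ray t x)) has_real_derivative h n (Suc j) (ray t x)) (at t)"
      if "t \<in> ival R" for n t using der[OF that] .
    show "continuous_on (ival R) (\<lambda>t. h n (Suc j) (ray t x))" for n
      by (intro continuous_at_imp_continuous_on ballI DERIV_isCont[OF der])
  qed

  \<comment> \<open>The ray on which the witness is read off.\<close>
  obtain x0 where x0: "x0 \<in> annulus" "good x0"
  proof -
    have "\<exists>x. x \<in> annulus \<and> good x"
    proof (rule ccontr)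
      assume "\<not> ?thesis"
      then have "AE x in lborel. (x::'a) \<notin> annulus" using AE_good by auto
      then have "emeasure lborel (annulus :: 'a set) = 0"
        by (subst (asm) AE_iff_measurable[of annulus]) auto
      then show False using annulus_not_null by blast
    qed
    then show ?thesis using that by blast
  qed
  have x0n: "x0 \<noteq> 0" using x0 by (auto simp: annulus_def)

  \<comment> \<open>Order 0 is \<open>v\<close> on every ray; uniqueness of derivatives lifts
    agreement almost everywhere from order \<open>j\<close> to \<open>Suc j\<close>.\<close>
  have uniq: "AE t in lborel. t \<in> ival R \<longrightarrow> H j (ray t x) = H j (ray t x0)"
    if x: "x \<in> annulus" "good x" and j: "j \<le> k" for x j
    using j
  proof (induction j)
    case 0
    have "x \<noteq> 0" using x by (auto simp: annulus_def)
    then show ?case using H0 x0n by simp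
  next
    case (Suc j)
    then have j: "j < k" and ih: "AE t in lborel. t \<in> ival R \<longrightarrow> H j (ray t x) = H j (ray t x0)"
      by simp_all
    show ?case by (rule approx_deriv_unique[OF approx[OF x j] approx[OF x0 j] ih])
  qed

  \<comment> \<open>\<open>w 0\<close> is \<open>v\<close> by definition of a witness; outside
    \<open>ival R\<close> the two branches need not match for \<open>j = 0\<close>.\<close>
  define w where "w j = (if j = 0 then v else (\<lambda>t. H j (ray t x0)))" for j
  have wH: "w j t = H j (ray t x0)" if "t \<in> ival R" for j t
    using H0[OF x0n that] by (simp add: w_def)
  have witness: "wsob_witness k p R DIM('a) v w"
    unfolding wsob_witness_def
  proof (intro conjI allI impI)
    show "w 0 = v" by (simp add: w_def)
    show "weak_deriv R (w j) (w (Suc j))" if "j < k" for j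
    proof (rule weak_deriv_cong[of R "\<lambda>t. H j (ray t x0)"])
      show "weak_deriv R (\<lambda>t. H j (ray t x0)) (w (Suc j))"
        using approx_deriv_imp_weak_deriv[OF approx[OF x0 that]] by (simp add: w_def)
    qed (simp add: wH)
    show "set_integrable lborel (ival R) (\<lambda>t. \<bar>w j t\<bar> powr p * sinh t ^ (DIM('a) - 1))" if j: "j \<le> k" for j
    proof -
      note [measurable] = Hm[OF j]
      have [measurable]: "ival R \<in> sets borel" using ival_open by (rule borel_open)
      have eq: "indicator (ival R) t *\<^sub>R (\<bar>w j t\<bar> powr p * sinh t ^ (DIM('a) - 1))
        = indicator (ival R) t *\<^sub>R (\<bar>H j (ray t x0)\<bar> powr p * sinh t ^ M)" for t
        using wH[of t j] by (simp add: M_def split: split_indicator)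
      show ?thesis unfolding set_integrable_def eq
      proof (rule integrableI_bounded)
        show "(\<lambda>t. indicator (ival R) t *\<^sub>R (\<bar>H j (ray t x0)\<bar> powr p * sinh t ^ M)) \<in> borel_measurable lborel"
          by measurable
        have "(\<integral>\<^sup>+t. ennreal (norm (indicator (ival R) t *\<^sub>R (\<bar>H j (ray t x0)\<bar> powr p * sinh t ^ M))) \<partial>lborel) \<le> L j x0"
          unfolding L_def
        proof (intro nn_integral_mono)
          fix t :: real
          show "ennreal (norm (indicator (ival R) t *\<^sub>R (\<bar>H j (ray t x0)\<bar> powr p * sinh t ^ M)))
            \<le> ennreal (\<bar>H j (ray t x0)\<bar> powr p) * ennreal (sinh t ^ M) * indicator {0<..} t"
            by (cases "t \<in> ival R") (auto simp: ival_def abs_mult ennreal_mult)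
        qed
        also have "\<dots> < \<infinity>" using x0 j by (simp add: good_def)
        finally show "(\<integral>\<^sup>+t. ennreal (norm (indicator (ival R) t *\<^sub>R (\<bar>H j (ray t x0)\<bar> powr p * sinh t ^ M))) \<partial>lborel) < \<infinity>" .
      qed
    qed
  qed

  have AE_eq: "AE y in lborel. y \<in> ?B \<longrightarrow> H k y = H k (ray (hdist y) x0)"
  proof -
    note [measurable] = Hm[OF order_refl]
    \<comment> \<open>The points where \<open>H k\<close> fails to be radial. Since
      \<open>hdist (ray t x) = t\<close>, \<open>uniq\<close> says that a good ray meets
      \<open>Q\<close> only for a null set of times.\<close>
    define Q where "Q = {y \<in> ?B. H k y \<noteq> H k (ray (hdist y) x0)}"
    have [measurable]: "Q \<in> sets borel" unfolding Q_def by measurable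
    have "AE x in lborel. (\<integral>\<^sup>+t. indicator Q (ray t x) * ennreal (sinh t ^ (DIM('a) - 1)) * indicator {0<..} t \<partial>lborel) * indicator annulus x = (0::ennreal)"
      using AE_good
    proof eventually_elim
      case (elim x)
      show ?case
      proof (cases "x \<in> annulus")
        case True
        then have x: "good x" "x \<noteq> 0" using elim by (auto simp: annulus_def)
        have "AE t in lborel. indicator Q (ray t x) * ennreal (sinh t ^ (DIM('a) - 1)) * indicator {0<..} t = 0"
          using uniq[OF True x(1) order_refl]
        proof eventually_elim
          case (elim t)
          show ?case
          proof (cases "t > 0 \<and> ray t x \<in> Q")
            case True
            then have t: "t > 0" "ray t x \<in> ?B" "H k (ray t x) \<noteq> H k (ray (hdist (ray t x)) x0)"
              by (auto simp: Q_def)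
            then have "t \<in> ival R" using ray_ball[OF x(2) t(1)] by simp
            moreover have "hdist (ray t x) = t" using hdist_ray[OF x(2), of t] t by simp
            ultimately show ?thesis using elim t by simp
          qed auto
        qed
        then have "(\<integral>\<^sup>+t. indicator Q (ray t x) * ennreal (sinh t ^ (DIM('a) - 1)) * indicator {0<..} t \<partial>lborel) = 0"
          by (subst nn_integral_0_iff_AE) measurable
        then show ?thesis by simp
      qed simp
    qed
    then have "(\<integral>\<^sup>+x. (\<integral>\<^sup>+t. indicator Q (ray t x) * ennreal (sinh t ^ (DIM('a) - 1)) * indicator {0<..} t \<partial>lborel) * indicator annulus x \<partial>lborel) = 0"
      by (subst nn_integral_0_iff_AE) measurable
    \<comment> \<open>The ray integrals of the indicator of \<open>Q\<close> vanish,
      \<open>ray_const\<close> is nonzero and \<open>hdens\<close> is positive on the ball, so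
      \<open>Q\<close> is a null set.\<close>
    then have "ray_const DIM('a) * (\<integral>\<^sup>+y. indicator Q y * ennreal (hdens y) * indicator (ball 0 1) y \<partial>lborel) = 0"
      by (subst (asm) nn_integral_rays) measurable
    then have "(\<integral>\<^sup>+y. indicator Q y * ennreal (hdens y) * indicator (ball 0 1) y \<partial>lborel) = 0"
      using ray_const_pos by simp
    moreover have [measurable]: "ball (0::'a) 1 \<in> sets borel" by simp
    ultimately have "AE y in lborel. indicator Q y * ennreal (hdens y) * indicator (ball 0 1) y = 0"
      by (subst (asm) nn_integral_0_iff_AE) measurable
    then show ?thesis
    proof eventually_elim
      case (elim y)
      show ?case
      proof
        assume y: "y \<in> ?B"
        then have "hdens y > 0" "y \<in> ball 0 1" using hdens_pos[of y] Bball[OF y] by auto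
        then have "y \<notin> Q" using elim by (auto simp: indicator_def ennreal_eq_0_iff split: if_splits)
        then show "H k y = H k (ray (hdist y) x0)" using y by (simp add: Q_def)
      qed
    qed
  qed
  have "AE x in lborel. x \<in> ?B - {0} \<longrightarrow> \<bar>w k (hdist x)\<bar> \<le> tnorm k (G k x) x"
    using AE_eq
  proof eventually_elim
    case (elim x)
    show ?case
    proof
      assume x: "x \<in> ?B - {0}"
      \<comment> \<open>\<open>k \<ge> 1\<close> selects the branch of \<open>w\<close> read off the
        chosen ray, which \<open>AE_eq\<close> identifies with \<open>H k x\<close>.\<close>
      have "w k (hdist x) = H k x" using elim x assms(1) by (simp add: w_def)
      also have "\<dots> = radial_part k (G k x) x" using x by (simp add: H_def)
      finally show "\<bar>w k (hdist x)\<bar> \<le> tnorm k (G k x) x"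
        using abs_radial_part_le_tnorm[OF Bball] x by simp
    qed
  qed
  then show ?thesis using witness unfolding wsobolev_def by blast
qed

end
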